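(* Let $n\geq 3$ and let $\rho_{A_1A_2A_3}$ be a state (density matrix) on $H_{A_1}\otimes H_{A_2}\otimes H_{A_3}$ with $\dim H_{A_1}=\dim H_{A_2}=2$ and $\dim H_{A_3}=2^{n-2}$ (a $2\otimes 2\otimes 2^{n-2}$ state). Let $k\geq 1$, $\frac12\leq p\leq 1$, $r\geq 2$ and $0\leq \alpha\leq \frac r2$, and put $$l=\frac{(1+k)^{\alpha/r}-p^{\alpha/r}}{k^{\alpha/r}}.$$ (1) If $C^r(\rho_{A_1A_3})\geq k\,C^r(\rho_{A_1A_2})$, then $$C^\alpha(\rho_{A_1|A_2A_3})\geq p^{\alpha/r}C^\alpha(\rho_{A_1A_2})+l\,C^\alpha(\rho_{A_1A_3}).$$ (2) If $C^r(\rho_{A_1A_2})\geq k\,C^r(\rho_{A_1A_3})$, then $$C^\alpha(\rho_{A_1|A_2A_3})\geq p^{\alpha/r}C^\alpha(\rho_{A_1A_3})+l\,C^\alpha(\rho_{A_1A_2}).$$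
   Context: For a bipartite pure state $|\varphi\rangle_{XY}\in H_X\otimes H_Y$, its concurrence is $C(|\varphi\rangle)=\sqrt{2[1-\mathrm{tr}(\rho_X^2)]}$ where $\rho_X=\mathrm{tr}_Y|\varphi\rangle\langle\varphi|$. For a mixed bipartite state $\rho_{XY}$, $C(\rho_{XY})=\min\sum_i p_i C(|\varphi_i\rangle)$, the minimum over all pure-state ensembles $\{p_i,|\varphi_i\rangle\}$ with $\rho_{XY}=\sum_ip_i|\varphi_i\rangle\langle\varphi_i|$. $\rho_{A_1A_2}=\mathrm{tr}_{A_3}\rho_{A_1A_2A_3}$ and $\rho_{A_1A_3}=\mathrm{tr}_{A_2}\rho_{A_1A_2A_3}$ are reduced states, and $\rho_{A_1|A_2A_3}$ denotes $\rho_{A_1A_2A_3}$ regarded as a bipartite state with respect to the bipartition $A_1$ versus $A_2A_3$. $C^\alpha$ denotes the $\alpha$-th power of the concurrence. *)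

theory Defs
  imports Complex_Main
begin

text \<open>Finite-dimensional operators on C^N are represented as functions
  nat => nat => complex, only entries with indices below N being relevant;
  vectors of C^N as nat => complex.  Tensor products use the standard
  (lexicographic) index ordering: basis vector (a,b) of C^dX (x) C^dY has
  index a*dY + b.\<close>

definition is_state :: "nat \<Rightarrow> (nat \<Rightarrow> nat \<Rightarrow> complex) \<Rightarrow> bool" where
  "is_state N \<rho> \<longleftrightarrow>
     (\<forall>i<N. \<forall>j<N. \<rho> j i = cnj (\<rho> i j)) \<and>
     (\<forall>v :: nat \<Rightarrow> complex. 0 \<le> Re (\<Sum>i<N. \<Sum>j<N. cnj (v i) * \<rho> i j * v j)) \<and>
     (\<Sum>i<N. \<rho> i i) = 1"

definition unit_vec :: "nat \<Rightarrow> (nat \<Rightarrow> complex) \<Rightarrow> bool" where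
  "unit_vec N \<phi> \<longleftrightarrow> (\<Sum>i<N. (cmod (\<phi> i))\<^sup>2) = 1"

definition reduced_pure :: "nat \<Rightarrow> (nat \<Rightarrow> complex) \<Rightarrow> nat \<Rightarrow> nat \<Rightarrow> complex" where
  "reduced_pure dY \<phi> i j = (\<Sum>b<dY. \<phi> (i * dY + b) * cnj (\<phi> (j * dY + b)))"

definition conc_pure :: "nat \<Rightarrow> nat \<Rightarrow> (nat \<Rightarrow> complex) \<Rightarrow> real" where
  "conc_pure dX dY \<phi> =
     sqrt (2 * (1 - Re (\<Sum>i<dX. \<Sum>j<dX. reduced_pure dY \<phi> i j * reduced_pure dY \<phi> j i)))"

definition is_ensemble :: "nat \<Rightarrow> (nat \<Rightarrow> nat \<Rightarrow> complex) \<Rightarrow> (real \<times> (nat \<Rightarrow> complex)) list \<Rightarrow> bool" where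
  "is_ensemble N \<rho> E \<longleftrightarrow>
     (\<forall>(p, \<phi>) \<in> set E. 0 \<le> p \<and> unit_vec N \<phi>) \<and>
     sum_list (map fst E) = 1 \<and>
     (\<forall>i<N. \<forall>j<N. \<rho> i j = (\<Sum>(p, \<phi>)\<leftarrow>E. of_real p * \<phi> i * cnj (\<phi> j)))"

definition conc :: "nat \<Rightarrow> nat \<Rightarrow> (nat \<Rightarrow> nat \<Rightarrow> complex) \<Rightarrow> real" where
  "conc dX dY \<rho> =
     Inf {(\<Sum>(p, \<phi>)\<leftarrow>E. p * conc_pure dX dY \<phi>) | E. is_ensemble (dX * dY) \<rho> E}"

definition ptrace_last :: "nat \<Rightarrow> (nat \<Rightarrow> nat \<Rightarrow> complex) \<Rightarrow> nat \<Rightarrow> nat \<Rightarrow> complex" where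
  "ptrace_last d3 \<rho> a b = (\<Sum>c<d3. \<rho> (a * d3 + c) (b * d3 + c))"

definition ptrace_mid :: "nat \<Rightarrow> nat \<Rightarrow> (nat \<Rightarrow> nat \<Rightarrow> complex) \<Rightarrow> nat \<Rightarrow> nat \<Rightarrow> complex" where
  "ptrace_mid d2 d3 \<rho> a b =
     (\<Sum>m<d2. \<rho> ((a div d3) * (d2 * d3) + m * d3 + a mod d3)
               ((b div d3) * (d2 * d3) + m * d3 + b mod d3))"

end

theory Submission
  imports Defs
begin

text \<open>
  The heart is the monogamy inequality \<open>C\<^sub>1\<^sub>|\<^sub>2\<^sub>3\<^sup>2 \<ge> C\<^sub>1\<^sub>2\<^sup>2 + C\<^sub>1\<^sub>3\<^sup>2\<close>. Write \<open>V\<^sub>2\<^sub>a\<^sub>+\<^sub>b\<close> for the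
  component in the third factor of a pure state at the basis vectors \<open>a\<close>, \<open>b\<close> of the two qubits, and
  let \<open>P\<close>, \<open>Q\<close> be the Gram matrices of \<open>(V\<^sub>0, V\<^sub>2)\<close> and \<open>(V\<^sub>1, V\<^sub>3)\<close>. Then
  \<open>C\<^sub>1\<^sub>|\<^sub>2\<^sub>3\<^sup>2 / 4 = det (P + Q) = (\<surd>det P + \<surd>det Q)\<^sup>2 + \<Gamma>\<close>, where the first summand is a quarter
  of the squared cost of the ensemble obtained by measuring the second qubit. The gap \<open>\<Gamma>\<close> bounds the
  \<open>(1,2)\<close>-state, the Gram matrix of all four vectors: its off-diagonal block is given by a
  contraction, which is a convex combination of unitary matrices, and \<open>\<Gamma>\<close> depends on the diagonal
  blocks only. For a unitary matrix the state has rank two, and it splits into a product vector and a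
  vector of squared half concurrence at most \<open>\<Gamma>\<close>. Mixed states follow from Minkowski's inequality.
  Finally, \<open>(1 + u)\<^sup>t - p\<^sup>t u\<^sup>t\<close> decreases in \<open>u \<in> [0, 1]\<close> for \<open>t \<le> 1/2 \<le> p\<close>, and \<open>l\<close> is its value
  at \<open>u = 1/k\<close>.
\<close>

section \<open>Inner products and Gram determinants\<close>

type_synonym cvec = "nat \<Rightarrow> complex"
type_synonym cmat = "nat \<Rightarrow> nat \<Rightarrow> complex"

definition cinner :: "nat \<Rightarrow> cvec \<Rightarrow> cvec \<Rightarrow> complex" where
  "cinner d x y = (\<Sum>c<d. x c * cnj (y c))"

definition norm_sq :: "nat \<Rightarrow> cvec \<Rightarrow> real" where
  "norm_sq d x = (\<Sum>c<d. (cmod (x c))\<^sup>2)"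

definition gram_det :: "nat \<Rightarrow> cvec \<Rightarrow> cvec \<Rightarrow> real" where
  "gram_det d x y = norm_sq d x * norm_sq d y - (cmod (cinner d x y))\<^sup>2"

lemma norm_sq_nonneg [simp]: "0 \<le> norm_sq d x"
  by (simp add: norm_sq_def sum_nonneg)

lemma norm_sq_eq_0_iff: "norm_sq d x = 0 \<longleftrightarrow> (\<forall>c<d. x c = 0)"
  unfolding norm_sq_def by (subst sum_nonneg_eq_0_iff) auto

lemma norm_sq_scale: "norm_sq d (\<lambda>c. a * x c) = (cmod a)\<^sup>2 * norm_sq d x"
  by (simp add: norm_sq_def norm_mult power_mult_distrib sum_distrib_left)

lemma cinner_self: "cinner d x x = of_real (norm_sq d x)"
  unfolding cinner_def norm_sq_def of_real_sum complex_norm_square ..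

lemma cnj_cinner: "cnj (cinner d x y) = cinner d y x"
  by (simp add: cinner_def mult.commute)

lemma cinner_scale_left: "cinner d (\<lambda>c. a * x c) y = a * cinner d x y"
  by (simp add: cinner_def sum_distrib_left mult_ac)

lemma cinner_scale_right: "cinner d x (\<lambda>c. a * y c) = cnj a * cinner d x y"
  by (simp add: cinner_def sum_distrib_left mult_ac)

lemma cinner_diff_left: "cinner d (\<lambda>c. x c - y c) z = cinner d x z - cinner d y z"
  by (simp add: cinner_def sum_subtractf algebra_simps)

lemma cinner_diff_right: "cinner d x (\<lambda>c. y c - z c) = cinner d x y - cinner d x z"
  by (simp add: cinner_def sum_subtractf algebra_simps)

lemma cinner_sum_left: "cinner d (\<lambda>c. \<Sum>k\<in>A. x k c) y = (\<Sum>k\<in>A. cinner d (x k) y)"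
  unfolding cinner_def sum_distrib_right by (rule sum.swap)

lemma cinner_sum_right: "cinner d x (\<lambda>c. \<Sum>k\<in>A. y k c) = (\<Sum>k\<in>A. cinner d x (y k))"
  unfolding cinner_def cnj_sum sum_distrib_left by (rule sum.swap)

lemmas cinner_linear = cinner_scale_left cinner_scale_right cinner_diff_left cinner_diff_right
  cinner_sum_left cinner_sum_right

lemma cinner_cong:
  "\<lbrakk>\<And>c. c < d \<Longrightarrow> x c = x' c; \<And>c. c < d \<Longrightarrow> y c = y' c\<rbrakk> \<Longrightarrow> cinner d x y = cinner d x' y'"
  by (simp add: cinner_def)

lemma of_real_gram_det:
  "complex_of_real (gram_det d x y)
    = cinner d x x * cinner d y y - cinner d x y * cinner d y x"
  unfolding gram_det_def of_real_diff of_real_mult cinner_self complex_norm_square cnj_cinner ..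

lemma gram_det_eqI:
  assumes "cinner d x x = cinner d' x' x'" "cinner d x y = cinner d' x' y'"
    "cinner d y y = cinner d' y' y'"
  shows "gram_det d x y = gram_det d' x' y'"
proof -
  have "cinner d y x = cinner d' y' x'" using assms(2) cnj_cinner by metis
  then have "complex_of_real (gram_det d x y) = of_real (gram_det d' x' y')"
    by (simp add: of_real_gram_det assms)
  then show ?thesis by (simp only: of_real_eq_iff)
qed

lemma gram_det_cong:
  "\<lbrakk>\<And>c. c < d \<Longrightarrow> x c = x' c; \<And>c. c < d \<Longrightarrow> y c = y' c\<rbrakk> \<Longrightarrow> gram_det d x y = gram_det d x' y'"
  by (intro gram_det_eqI cinner_cong)

lemma gram_det_2: "gram_det 2 x y = (cmod (x 0 * y 1 - x 1 * y 0))\<^sup>2"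
proof -
  have "complex_of_real (gram_det 2 x y) = (x 0 * y 1 - x 1 * y 0) * cnj (x 0 * y 1 - x 1 * y 0)"
    unfolding of_real_gram_det cinner_def by (simp add: numeral_2_eq_2 algebra_simps)
  also have "\<dots> = of_real ((cmod (x 0 * y 1 - x 1 * y 0))\<^sup>2)"
    by (rule complex_norm_square[symmetric])
  finally show ?thesis by (simp only: of_real_eq_iff)
qed

lemma gram_det_scale: "gram_det d (\<lambda>c. a * x c) (\<lambda>c. a * y c) = (cmod a) ^ 4 * gram_det d x y"
  by (simp add: gram_det_def norm_sq_scale cinner_linear norm_mult power_mult_distrib algebra_simps
      flip: power_mult power_add)

lemma gram_det_nonneg: "0 \<le> gram_det d x y"
proof (cases "norm_sq d y = 0")
  case True
  then have "cinner d x y = 0" by (simp add: norm_sq_eq_0_iff cinner_def)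
  then show ?thesis using True by (simp add: gram_det_def)
next
  case False
  let ?z = "\<lambda>c. cinner d y y * x c - cinner d x y * y c"
  have "complex_of_real (norm_sq d ?z) = cinner d ?z ?z" by (simp add: cinner_self)
  also have "\<dots> = cinner d y y * of_real (gram_det d x y)"
    unfolding of_real_gram_det by (simp only: cinner_linear) (simp add: cnj_cinner algebra_simps)
  also have "\<dots> = of_real (norm_sq d y * gram_det d x y)" by (simp add: cinner_self)
  finally have "norm_sq d ?z = norm_sq d y * gram_det d x y" by (simp only: of_real_eq_iff)
  then have "0 \<le> norm_sq d y * gram_det d x y" by (metis norm_sq_nonneg)
  then show ?thesis using False norm_sq_nonneg[of d y] by (simp add: zero_le_mult_iff)
qed

definition block :: "nat \<Rightarrow> cvec \<Rightarrow> nat \<Rightarrow> cvec" where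
  "block d x a = (\<lambda>c. x (a * d + c))"

lemma block_block: "b < m \<Longrightarrow> block d (block (m * d) x a) b = block d x (a * m + b)"
  by (simp add: block_def algebra_simps)

lemma sum_lessThan_mult:
  fixes f :: "nat \<Rightarrow> 'a::comm_monoid_add"
  shows "(\<Sum>i<m * d. f i) = (\<Sum>a<m. \<Sum>c<d. f (a * d + c))"
proof -
  have "(\<Sum>c<d. f (a * d + c)) = sum f {a * d..<a * d + d}" for a
    using sum.shift_bounds_nat_ivl[of f 0 "a * d" d] by (simp add: atLeast0LessThan add.commute)
  then show ?thesis by (simp add: sum.nat_group)
qed

lemma cinner_block: "cinner (m * d) x y = (\<Sum>a<m. cinner d (block d x a) (block d y a))"
  by (simp add: cinner_def sum_lessThan_mult block_def)

section \<open>Gram--Schmidt orthonormalisation\<close>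

text \<open>Zero vectors are admitted, so that linearly dependent families need no separate treatment.\<close>

definition suborthonormal :: "nat \<Rightarrow> nat \<Rightarrow> (nat \<Rightarrow> cvec) \<Rightarrow> bool" where
  "suborthonormal d n e \<longleftrightarrow>
     (\<forall>k<n. \<forall>l<n. k \<noteq> l \<longrightarrow> cinner d (e k) (e l) = 0) \<and> (\<forall>k<n. norm_sq d (e k) \<in> {0, 1})"

definition residual :: "nat \<Rightarrow> nat \<Rightarrow> (nat \<Rightarrow> cvec) \<Rightarrow> cvec \<Rightarrow> cvec" where
  "residual d n e x = (\<lambda>c. x c - (\<Sum>k<n. cinner d x (e k) * e k c))"

definition normalise :: "nat \<Rightarrow> cvec \<Rightarrow> cvec" where
  "normalise d x = (\<lambda>c. complex_of_real (inverse (sqrt (norm_sq d x))) * x c)"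

lemma normalise_scale: "c < d \<Longrightarrow> of_real (sqrt (norm_sq d x)) * normalise d x c = x c"
  by (cases "norm_sq d x = 0") (auto simp: normalise_def norm_sq_eq_0_iff)

lemma norm_sq_normalise: "norm_sq d (normalise d x) = (if norm_sq d x = 0 then 0 else 1)"
  by (auto simp: normalise_def norm_sq_scale norm_inverse power_inverse)

lemma cinner_normalise_self: "cinner d x (normalise d x) = of_real (sqrt (norm_sq d x))"
  by (simp add: normalise_def cinner_linear cinner_self divide_inverse[symmetric] real_div_sqrt
      mult.commute[of "inverse _"] flip: of_real_mult of_real_inverse)

lemma cinner_eq_0I: "norm_sq d y = 0 \<Longrightarrow> cinner d x y = 0"
  by (simp add: norm_sq_eq_0_iff cinner_def)

lemma suborthonormal_cinner:
  assumes "suborthonormal d n e" "k < n" "l < n"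
  shows "cinner d x (e k) * cinner d (e k) (e l) = (if k = l then cinner d x (e k) else 0)"
proof (cases "k = l")
  case True
  have "norm_sq d (e k) = 0 \<or> norm_sq d (e k) = 1"
    using assms by (auto simp: suborthonormal_def)
  then show ?thesis using True by (auto simp: cinner_self cinner_eq_0I)
qed (use assms in \<open>simp add: suborthonormal_def\<close>)

lemma cinner_residual_basis:
  assumes "suborthonormal d n e" "l < n"
  shows "cinner d (residual d n e x) (e l) = 0"
proof -
  have "cinner d (residual d n e x) (e l)
      = cinner d x (e l) - (\<Sum>k<n. cinner d x (e k) * cinner d (e k) (e l))"
    by (simp add: residual_def cinner_linear)
  also have "(\<Sum>k<n. cinner d x (e k) * cinner d (e k) (e l))
      = (\<Sum>k<n. if k = l then cinner d x (e k) else 0)"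
    using assms by (intro sum.cong) (auto simp: suborthonormal_cinner)
  finally show ?thesis using assms(2) by simp
qed

lemma cinner_residual_residual:
  assumes "suborthonormal d n e"
  shows "cinner d (residual d n e x) (residual d n e y)
    = cinner d x y - (\<Sum>k<n. cinner d x (e k) * cinner d (e k) y)"
proof -
  have "cinner d (residual d n e x) (residual d n e y) = cinner d (residual d n e x) y
      - (\<Sum>k<n. cnj (cinner d y (e k)) * cinner d (residual d n e x) (e k))"
    by (subst (2) residual_def) (simp add: cinner_linear)
  also have "\<dots> = cinner d (residual d n e x) y"
    using assms by (simp add: cinner_residual_basis)
  finally show ?thesis by (simp add: residual_def cinner_linear)
qed

lemma suborthonormal_extend:
  assumes sub_e: "suborthonormal d n e" and orthogonal: "\<And>k. k < n \<Longrightarrow> cinner d y (e k) = 0"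
  shows "suborthonormal d (Suc n) (e(n := normalise d y))"
proof -
  have left: "cinner d (normalise d y) (e k) = 0" if "k < n" for k
    using that by (simp add: normalise_def cinner_linear orthogonal)
  then have "cinner d (e k) (normalise d y) = 0" if "k < n" for k
    using that cnj_cinner complex_cnj_zero by metis
  then show ?thesis
    using sub_e left by (auto simp: suborthonormal_def less_Suc_eq norm_sq_normalise)
qed

definition expands :: "nat \<Rightarrow> nat \<Rightarrow> (nat \<Rightarrow> cvec) \<Rightarrow> cvec \<Rightarrow> bool" where
  "expands d n e x \<longleftrightarrow> (\<forall>c<d. x c = (\<Sum>k<n. cinner d x (e k) * e k c))"

definition sesquilinear_form :: "nat \<Rightarrow> cmat \<Rightarrow> cvec \<Rightarrow> cvec \<Rightarrow> complex" where
  "sesquilinear_form n W x y = (\<Sum>k<n. \<Sum>l<n. x k * W k l * cnj (y l))"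

lemma expands_cinner:
  assumes "expands d n e x"
  shows "cinner d x y = (\<Sum>k<n. cinner d x (e k) * cinner d (e k) y)"
proof -
  have "cinner d x y = cinner d (\<lambda>c. \<Sum>k<n. cinner d x (e k) * e k c) y"
    using assms by (intro cinner_cong) (auto simp: expands_def)
  then show ?thesis by (simp add: cinner_linear)
qed

lemma expands_Parseval:
  assumes "expands d n e x"
  shows "cinner d x y = cinner n (\<lambda>k. cinner d x (e k)) (\<lambda>k. cinner d y (e k))"
  by (subst expands_cinner[OF assms]) (simp add: cinner_def[of n] cnj_cinner)

lemma expands_cinner_cross:
  assumes "expands d n e x" "expands d n f y"
  shows "cinner d x y = sesquilinear_form n (\<lambda>k l. cinner d (e k) (f l))
    (\<lambda>k. cinner d x (e k)) (\<lambda>l. cinner d y (f l))"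
proof -
  have "cinner d (e k) y = (\<Sum>l<n. cinner d (e k) (f l) * cnj (cinner d y (f l)))" for k
    using expands_cinner[OF assms(2), of "e k", THEN arg_cong[where f = cnj]]
    by (simp add: cnj_cinner mult.commute)
  then show ?thesis
    by (subst expands_cinner[OF assms(1)])
      (simp add: sesquilinear_form_def sum_distrib_left mult.assoc)
qed

lemma Gram_Schmidt:
  fixes V :: "nat \<Rightarrow> cvec"
  shows "\<exists>e. suborthonormal d n e \<and> (\<forall>i<n. expands d n e (V i))"
proof (induction n)
  case 0
  show ?case by (simp add: suborthonormal_def)
next
  case (Suc n)
  then obtain e where sub_e: "suborthonormal d n e" and expands: "\<And>i. i < n \<Longrightarrow> expands d n e (V i)"
    by blast
  define y where "y = residual d n e (V n)"
  define e' where "e' = e(n := normalise d y)"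
  have e'_simps: "e' n = normalise d y" "k < n \<Longrightarrow> e' k = e k" for k by (simp_all add: e'_def)
  have sub_e': "suborthonormal d (Suc n) e'"
    unfolding e'_def y_def by (intro suborthonormal_extend sub_e cinner_residual_basis)
  then have orthogonal: "cinner d (e k) (normalise d y) = 0" if "k < n" for k
    using that unfolding suborthonormal_def by (metis e'_simps less_Suc_eq less_irrefl)
  have "expands d (Suc n) e' (V i)" if "i < n" for i
  proof -
    have "cinner d (V i) (normalise d y) = 0"
      by (subst expands_cinner[OF expands[OF that]]) (simp add: orthogonal)
    then show ?thesis using expands[OF that] by (simp add: expands_def e'_simps)
  qed
  moreover have "expands d (Suc n) e' (V n)"
  proof -
    have "cinner d (V n) (normalise d y) = cinner d (residual d n e (V n)) (normalise d y)"
      by (simp add: residual_def cinner_linear orthogonal)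
    also have "\<dots> = of_real (sqrt (norm_sq d y))"
      by (simp add: cinner_normalise_self flip: y_def)
    finally have "cinner d (V n) (normalise d y) * normalise d y c = y c" if "c < d" for c
      using normalise_scale[OF that, of y] by simp
    then show ?thesis by (simp add: expands_def e'_simps) (simp add: y_def residual_def)
  qed
  ultimately show ?case using sub_e' by (auto simp: less_Suc_eq)
qed

section \<open>Unnormalised ensembles\<close>

text \<open>The concurrence of a vector that need not be normalised: being homogeneous of degree two, it
  absorbs the probabilities of an ensemble into the vectors.\<close>

definition conc_vec :: "nat \<Rightarrow> nat \<Rightarrow> cvec \<Rightarrow> real" where
  "conc_vec dX dY \<phi>
    = sqrt (2 * (\<Sum>i<dX. \<Sum>j<dX. gram_det dY (block dY \<phi> i) (block dY \<phi> j)))"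

definition outer :: "cvec \<Rightarrow> cmat" where
  "outer v i j = v i * cnj (v j)"

definition trace :: "nat \<Rightarrow> cmat \<Rightarrow> complex" where
  "trace N \<rho> = (\<Sum>i<N. \<rho> i i)"

definition is_decomposition :: "nat \<Rightarrow> cmat \<Rightarrow> cvec list \<Rightarrow> bool" where
  "is_decomposition N \<rho> L \<longleftrightarrow> (\<forall>i<N. \<forall>j<N. \<rho> i j = (\<Sum>v\<leftarrow>L. outer v i j))"

lemma mult_add_less_mult: "\<lbrakk>a < m; c < d\<rbrakk> \<Longrightarrow> a * d + c < m * d" for a c d m :: nat
  using mult_le_mono1[of "Suc a" m d] by simp

lemma outer_scale_sqrt:
  "0 \<le> t \<Longrightarrow> outer (\<lambda>i. complex_of_real (sqrt t) * v i) i j = of_real t * outer v i j"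
  by (simp add: outer_def mult_ac flip: of_real_mult)

lemma conc_vec_nonneg: "0 \<le> conc_vec dX dY \<phi>"
  by (simp add: conc_vec_def sum_nonneg gram_det_nonneg)

lemma conc_vec_cong:
  "(\<And>i. i < dX * dY \<Longrightarrow> \<phi> i = \<psi> i) \<Longrightarrow> conc_vec dX dY \<phi> = conc_vec dX dY \<psi>"
  unfolding conc_vec_def
  by (intro arg_cong[where f = sqrt] arg_cong[where f = "(*) 2"] sum.cong refl gram_det_cong)
    (auto simp: block_def mult_add_less_mult)

lemma conc_vec_scale: "conc_vec dX dY (\<lambda>i. a * \<phi> i) = (cmod a)\<^sup>2 * conc_vec dX dY \<phi>"
proof -
  have "block dY (\<lambda>i. a * \<phi> i) i = (\<lambda>c. a * block dY \<phi> i c)" for i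
    by (simp add: block_def)
  then have "conc_vec dX dY (\<lambda>i. a * \<phi> i) = sqrt (((cmod a)\<^sup>2)\<^sup>2
      * (2 * (\<Sum>i<dX. \<Sum>j<dX. gram_det dY (block dY \<phi> i) (block dY \<phi> j))))"
    by (simp add: conc_vec_def gram_det_scale sum_distrib_left mult_ac flip: power_mult)
  then show ?thesis by (simp only: conc_vec_def real_sqrt_mult real_sqrt_abs abs_power2)
qed

lemma conc_vec_qubit:
  "conc_vec 2 d \<phi> = 2 * sqrt (gram_det d (block d \<phi> 0) (block d \<phi> 1))"
proof -
  have "gram_det d x x = 0" for x by (simp add: gram_det_def cinner_self power2_eq_square)
  moreover have "gram_det d y x = gram_det d x y" for x y
    by (simp add: gram_det_def mult.commute flip: cnj_cinner[of d x y])
  ultimately have "conc_vec 2 d \<phi> = sqrt (2\<^sup>2 * gram_det d (block d \<phi> 0) (block d \<phi> 1))"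
    by (simp add: conc_vec_def numeral_2_eq_2)
  then show ?thesis by (simp add: real_sqrt_mult)
qed

lemma conc_pure_eq_conc_vec:
  assumes "unit_vec (dX * dY) \<phi>"
  shows "conc_pure dX dY \<phi> = conc_vec dX dY \<phi>"
proof -
  let ?r = "reduced_pure dY \<phi>"
  have reduced: "?r i j = cinner dY (block dY \<phi> i) (block dY \<phi> j)" for i j
    by (simp add: reduced_pure_def cinner_def block_def)
  have "(\<Sum>i<dX. ?r i i) = cinner (dX * dY) \<phi> \<phi>" by (simp add: reduced cinner_block)
  also have "\<dots> = 1" using assms by (simp add: cinner_self norm_sq_def unit_vec_def)
  finally have "(\<Sum>i<dX. \<Sum>j<dX. ?r i i * ?r j j) = 1" by (simp flip: sum_product)
  then have "complex_of_real (\<Sum>i<dX. \<Sum>j<dX. gram_det dY (block dY \<phi> i) (block dY \<phi> j))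
      = 1 - (\<Sum>i<dX. \<Sum>j<dX. ?r i j * ?r j i)"
    by (simp add: of_real_gram_det sum_subtractf reduced)
  from arg_cong[OF this, of Re]
  have "(\<Sum>i<dX. \<Sum>j<dX. gram_det dY (block dY \<phi> i) (block dY \<phi> j))
      = 1 - Re (\<Sum>i<dX. \<Sum>j<dX. ?r i j * ?r j i)"
    by (simp only: Re_complex_of_real minus_complex.sel one_complex.sel)
  then show ?thesis by (simp add: conc_pure_def conc_vec_def)
qed

lemma unit_vec_direction:
  assumes "0 < N"
  shows "\<exists>u. unit_vec N u \<and> (\<forall>i<N. v i = complex_of_real (sqrt (norm_sq N v)) * u i)"
proof (cases "norm_sq N v = 0")
  case True
  let ?u = "\<lambda>i. if i = 0 then 1 else 0 :: complex"
  have "(\<Sum>i<N. (cmod (?u i))\<^sup>2) = (\<Sum>i<N. if i = 0 then 1 else 0)" by (intro sum.cong) auto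
  then have "unit_vec N ?u" using assms by (simp add: unit_vec_def)
  then show ?thesis using True by (auto simp: norm_sq_eq_0_iff)
next
  case False
  then have "unit_vec N (normalise N v)"
    using norm_sq_normalise[of N v] by (simp add: unit_vec_def norm_sq_def)
  then show ?thesis using normalise_scale by metis
qed

lemma ensemble_of_decomposition:
  assumes trace: "trace (dX * dY) \<rho> = 1" and decomposition: "is_decomposition (dX * dY) \<rho> L"
  obtains E where "is_ensemble (dX * dY) \<rho> E"
    "(\<Sum>(p, \<phi>)\<leftarrow>E. p * conc_pure dX dY \<phi>) = (\<Sum>v\<leftarrow>L. conc_vec dX dY v)"
proof -
  let ?N = "dX * dY"
  have "0 < ?N" using trace by (intro gr0I) (simp add: trace_def)
  then obtain u where unit: "\<And>v. unit_vec ?N (u v)"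
    and direction: "\<And>v i. i < ?N \<Longrightarrow> v i = complex_of_real (sqrt (norm_sq ?N v)) * u v i"
    using unit_vec_direction by metis
  define E where "E = map (\<lambda>v. (norm_sq ?N v, u v)) L"
  have "of_real (norm_sq ?N v) * u v i * cnj (u v j) = outer v i j" if "i < ?N" "j < ?N" for v i j
  proof -
    have "outer v i j = outer (\<lambda>i. complex_of_real (sqrt (norm_sq ?N v)) * u v i) i j"
      unfolding outer_def using direction[OF that(1), of v] direction[OF that(2), of v]
      by (rule arg_cong2)
    then show ?thesis by (simp add: outer_scale_sqrt) (simp add: outer_def mult.assoc)
  qed
  moreover have "(\<Sum>v\<leftarrow>L. norm_sq ?N v) = 1"
  proof -
    have "complex_of_real (\<Sum>v\<leftarrow>L. norm_sq ?N v) = (\<Sum>v\<leftarrow>L. \<Sum>i<?N. outer v i i)"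
      by (induction L) (simp_all add: outer_def flip: cinner_def cinner_self)
    also have "\<dots> = (\<Sum>i<?N. \<Sum>v\<leftarrow>L. outer v i i)"
      by (induction L) (simp_all add: sum.distrib)
    also have "\<dots> = of_real 1"
      using trace decomposition by (simp add: trace_def is_decomposition_def)
    finally show ?thesis by (simp only: of_real_eq_iff)
  qed
  ultimately have "is_ensemble ?N \<rho> E"
    using decomposition unit by (auto simp: is_ensemble_def is_decomposition_def E_def o_def)
  moreover have "norm_sq ?N v * conc_pure dX dY (u v) = conc_vec dX dY v" for v
  proof -
    have "conc_vec dX dY v = conc_vec dX dY (\<lambda>i. complex_of_real (sqrt (norm_sq ?N v)) * u v i)"
      by (intro conc_vec_cong direction)
    then show ?thesis by (simp add: conc_vec_scale conc_pure_eq_conc_vec unit)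
  qed
  ultimately show ?thesis using that by (simp add: E_def o_def)
qed

lemma decomposition_of_ensemble:
  assumes "is_ensemble (dX * dY) \<rho> E"
  obtains L where "is_decomposition (dX * dY) \<rho> L"
    "(\<Sum>v\<leftarrow>L. conc_vec dX dY v) = (\<Sum>(p, \<phi>)\<leftarrow>E. p * conc_pure dX dY \<phi>)"
proof
  let ?f = "\<lambda>(p, \<phi>) i. complex_of_real (sqrt p) * \<phi> i"
  have member: "0 \<le> p" "unit_vec (dX * dY) \<phi>" if "(p, \<phi>) \<in> set E" for p \<phi>
    using assms that by (auto simp: is_ensemble_def)
  have "outer (?f x) i j = (case x of (p, \<phi>) \<Rightarrow> of_real p * \<phi> i * cnj (\<phi> j))"
    if "x \<in> set E" for x i j
  proof (cases x)
    case (Pair p \<phi>)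
    then have "outer (?f x) i j = of_real p * outer \<phi> i j"
      using member that by (simp add: outer_scale_sqrt)
    then show ?thesis using Pair by (simp add: outer_def mult.assoc)
  qed
  then show "is_decomposition (dX * dY) \<rho> (map ?f E)"
    using assms by (simp add: is_ensemble_def is_decomposition_def o_def cong: map_cong)
  have "conc_vec dX dY (?f x) = (case x of (p, \<phi>) \<Rightarrow> p * conc_pure dX dY \<phi>)"
    if "x \<in> set E" for x
    using member that by (auto simp: conc_vec_scale conc_pure_eq_conc_vec split: prod.splits)
  then show "(\<Sum>v\<leftarrow>map ?f E. conc_vec dX dY v) = (\<Sum>(p, \<phi>)\<leftarrow>E. p * conc_pure dX dY \<phi>)"
    by (simp add: o_def cong: map_cong)
qed

definition ensemble_conc_le :: "nat \<Rightarrow> nat \<Rightarrow> cmat \<Rightarrow> real \<Rightarrow> bool" where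
  "ensemble_conc_le dX dY \<rho> \<kappa> \<longleftrightarrow>
     (\<exists>L. is_decomposition (dX * dY) \<rho> L \<and> (\<Sum>v\<leftarrow>L. conc_vec dX dY v) \<le> \<kappa>)"

lemma ensemble_conc_leI:
  "\<lbrakk>is_decomposition (dX * dY) \<rho> L; (\<Sum>v\<leftarrow>L. conc_vec dX dY v) \<le> \<kappa>\<rbrakk> \<Longrightarrow> ensemble_conc_le dX dY \<rho> \<kappa>"
  by (auto simp: ensemble_conc_le_def)

lemma sum_conc_vec_nonneg: "0 \<le> (\<Sum>v\<leftarrow>L. conc_vec dX dY v)"
  by (rule sum_list_nonneg) (auto simp: conc_vec_nonneg)

lemma ensemble_conc_le_nonneg: "ensemble_conc_le dX dY \<rho> \<kappa> \<Longrightarrow> 0 \<le> \<kappa>"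
  using sum_conc_vec_nonneg order_trans unfolding ensemble_conc_le_def by blast

lemma ensemble_conc_le_cong:
  assumes "\<And>i j. \<lbrakk>i < dX * dY; j < dX * dY\<rbrakk> \<Longrightarrow> \<rho> i j = \<sigma> i j"
  shows "ensemble_conc_le dX dY \<rho> \<kappa> \<longleftrightarrow> ensemble_conc_le dX dY \<sigma> \<kappa>"
  using assms by (simp add: ensemble_conc_le_def is_decomposition_def)

lemma ensemble_conc_le_zero:
  "(\<And>i j. \<lbrakk>i < dX * dY; j < dX * dY\<rbrakk> \<Longrightarrow> \<rho> i j = 0) \<Longrightarrow> ensemble_conc_le dX dY \<rho> 0"
  by (rule ensemble_conc_leI[of _ _ _ "[]"]) (simp_all add: is_decomposition_def)

lemma ensemble_conc_le_add:
  assumes "ensemble_conc_le dX dY \<rho> \<kappa>" "ensemble_conc_le dX dY \<sigma> \<mu>"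
  shows "ensemble_conc_le dX dY (\<lambda>i j. \<rho> i j + \<sigma> i j) (\<kappa> + \<mu>)"
proof -
  obtain L M where "is_decomposition (dX * dY) \<rho> L" "(\<Sum>v\<leftarrow>L. conc_vec dX dY v) \<le> \<kappa>"
    "is_decomposition (dX * dY) \<sigma> M" "(\<Sum>v\<leftarrow>M. conc_vec dX dY v) \<le> \<mu>"
    using assms by (auto simp: ensemble_conc_le_def)
  then show ?thesis
    by (intro ensemble_conc_leI[of _ _ _ "L @ M"]) (simp_all add: is_decomposition_def)
qed

lemma ensemble_conc_le_scale:
  assumes "ensemble_conc_le dX dY \<rho> \<kappa>" "0 \<le> t"
  shows "ensemble_conc_le dX dY (\<lambda>i j. of_real t * \<rho> i j) (t * \<kappa>)"
proof -
  obtain L where decomposition: "is_decomposition (dX * dY) \<rho> L"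
    and cost: "(\<Sum>v\<leftarrow>L. conc_vec dX dY v) \<le> \<kappa>"
    using assms by (auto simp: ensemble_conc_le_def)
  let ?f = "\<lambda>v i. complex_of_real (sqrt t) * v i"
  have "is_decomposition (dX * dY) (\<lambda>i j. of_real t * \<rho> i j) (map ?f L)"
    using decomposition assms(2)
    by (simp add: is_decomposition_def o_def outer_scale_sqrt sum_list_const_mult)
  moreover have "(\<Sum>v\<leftarrow>map ?f L. conc_vec dX dY v) \<le> t * \<kappa>"
    using assms(2) cost by (simp add: o_def conc_vec_scale sum_list_const_mult mult_left_mono)
  ultimately show ?thesis by (rule ensemble_conc_leI)
qed

lemma ensemble_cost_nonneg:
  "is_ensemble (dX * dY) \<rho> E \<Longrightarrow> 0 \<le> (\<Sum>(p, \<phi>)\<leftarrow>E. p * conc_pure dX dY \<phi>)"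
  by (intro sum_list_nonneg)
    (auto simp: is_ensemble_def conc_pure_eq_conc_vec conc_vec_nonneg)

lemma conc_le:
  assumes "trace (dX * dY) \<rho> = 1" "ensemble_conc_le dX dY \<rho> \<kappa>"
  shows "conc dX dY \<rho> \<le> \<kappa>"
proof -
  obtain L where decomposition: "is_decomposition (dX * dY) \<rho> L"
    and cost: "(\<Sum>v\<leftarrow>L. conc_vec dX dY v) \<le> \<kappa>"
    using assms(2) by (auto simp: ensemble_conc_le_def)
  obtain E where ensemble: "is_ensemble (dX * dY) \<rho> E"
    and cost_eq: "(\<Sum>(p, \<phi>)\<leftarrow>E. p * conc_pure dX dY \<phi>) = (\<Sum>v\<leftarrow>L. conc_vec dX dY v)"
    by (rule ensemble_of_decomposition[OF assms(1) decomposition])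
  have "bdd_below {(\<Sum>(p, \<phi>)\<leftarrow>E. p * conc_pure dX dY \<phi>) | E. is_ensemble (dX * dY) \<rho> E}"
    by (rule bdd_belowI[of _ 0]) (auto dest: ensemble_cost_nonneg)
  then have "conc dX dY \<rho> \<le> (\<Sum>(p, \<phi>)\<leftarrow>E. p * conc_pure dX dY \<phi>)"
    unfolding conc_def using ensemble by (intro cInf_lower) auto
  then show ?thesis using cost_eq cost by simp
qed

text \<open>The decomposition is needed because the infimum of the empty set is unspecified.\<close>

lemma conc_greatest:
  assumes "trace (dX * dY) \<rho> = 1" and "is_decomposition (dX * dY) \<rho> L"
    and lower_bound: "\<And>L. is_decomposition (dX * dY) \<rho> L \<Longrightarrow> x \<le> (\<Sum>v\<leftarrow>L. conc_vec dX dY v)"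
  shows "x \<le> conc dX dY \<rho>"
  unfolding conc_def
proof (rule cInf_greatest)
  show "{(\<Sum>(p, \<phi>)\<leftarrow>E. p * conc_pure dX dY \<phi>) | E. is_ensemble (dX * dY) \<rho> E} \<noteq> {}"
    using ensemble_of_decomposition[OF assms(1,2)] by blast
next
  fix y assume "y \<in> {(\<Sum>(p, \<phi>)\<leftarrow>E. p * conc_pure dX dY \<phi>) | E. is_ensemble (dX * dY) \<rho> E}"
  then obtain E where ensemble: "is_ensemble (dX * dY) \<rho> E"
    and y: "y = (\<Sum>(p, \<phi>)\<leftarrow>E. p * conc_pure dX dY \<phi>)"
    by blast
  obtain L where "is_decomposition (dX * dY) \<rho> L"
    "(\<Sum>v\<leftarrow>L. conc_vec dX dY v) = (\<Sum>(p, \<phi>)\<leftarrow>E. p * conc_pure dX dY \<phi>)"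
    by (rule decomposition_of_ensemble[OF ensemble])
  then show "x \<le> y" using lower_bound unfolding y by metis
qed

lemma conc_nonneg:
  assumes "trace (dX * dY) \<rho> = 1" "ensemble_conc_le dX dY \<rho> \<kappa>"
  shows "0 \<le> conc dX dY \<rho>"
  using assms conc_greatest[of dX dY \<rho> _ 0] sum_conc_vec_nonneg
  unfolding ensemble_conc_le_def by blast

section \<open>Positive semidefinite matrices\<close>

definition quadratic_form :: "nat \<Rightarrow> cmat \<Rightarrow> cvec \<Rightarrow> complex" where
  "quadratic_form N \<rho> v = (\<Sum>i<N. \<Sum>j<N. cnj (v i) * \<rho> i j * v j)"

definition psd :: "nat \<Rightarrow> cmat \<Rightarrow> bool" where
  "psd N \<rho> \<longleftrightarrow> (\<forall>i<N. \<forall>j<N. \<rho> j i = cnj (\<rho> i j)) \<and> (\<forall>v. 0 \<le> Re (quadratic_form N \<rho> v))"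

lemma is_state_iff: "is_state N \<rho> \<longleftrightarrow> psd N \<rho> \<and> trace N \<rho> = 1"
  by (auto simp: is_state_def psd_def quadratic_form_def trace_def)

lemma psd_hermitian: "\<lbrakk>psd N \<rho>; i < N; j < N\<rbrakk> \<Longrightarrow> cnj (\<rho> i j) = \<rho> j i"
  unfolding psd_def by metis

lemma psd_quadratic_form: "psd N \<rho> \<Longrightarrow> 0 \<le> Re (quadratic_form N \<rho> v)"
  by (simp add: psd_def)

lemma psd_column_sum:
  assumes "psd N \<rho>" "k < N"
  shows "(\<Sum>i<N. cnj (v i) * \<rho> i k) = cnj (\<Sum>j<N. \<rho> k j * v j)"
  unfolding cnj_sum using assms by (intro sum.cong) (simp_all add: psd_hermitian)

lemma psd_quadratic_form_shift:
  assumes "psd N \<rho>" and "k < N" and b_eq: "b = (\<Sum>j<N. \<rho> k j * v j)"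
  shows "quadratic_form N \<rho> (\<lambda>i. v i + (if i = k then t else 0))
    = quadratic_form N \<rho> v + cnj t * b + cnj b * t + cnj t * \<rho> k k * t"
proof -
  let ?\<delta> = "\<lambda>i. if i = k then t else 0"
  have rows: "quadratic_form N \<rho> w = (\<Sum>i<N. cnj (w i) * (\<Sum>j<N. \<rho> i j * w j))" for w
    by (simp add: quadratic_form_def sum_distrib_left mult.assoc)
  have unit: "(\<Sum>i<N. f i * ?\<delta> i) = f k * t" "(\<Sum>i<N. cnj (?\<delta> i) * f i) = cnj t * f k" for f
    using \<open>k < N\<close> by (simp_all add: if_distrib[where f = "\<lambda>x. f _ * x"] if_distrib[where f = cnj]
        if_distrib[where f = "\<lambda>x. x * f _"] cong: if_cong)
  have column: "(\<Sum>i<N. cnj (v i) * \<rho> i k) = cnj b"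
    unfolding b_eq using assms(1,2) by (rule psd_column_sum)
  have "(\<Sum>j<N. \<rho> i j * (v j + ?\<delta> j)) = (\<Sum>j<N. \<rho> i j * v j) + \<rho> i k * t" for i
    by (simp only: distrib_left sum.distrib unit)
  then have "quadratic_form N \<rho> (\<lambda>i. v i + ?\<delta> i)
      = (\<Sum>i<N. cnj (v i) * ((\<Sum>j<N. \<rho> i j * v j) + \<rho> i k * t)) + cnj t * (b + \<rho> k k * t)"
    by (simp only: rows complex_cnj_add distrib_right sum.distrib unit b_eq)
  also have "(\<Sum>i<N. cnj (v i) * ((\<Sum>j<N. \<rho> i j * v j) + \<rho> i k * t))
      = quadratic_form N \<rho> v + cnj b * t"
    by (simp add: rows distrib_left sum.distrib sum_distrib_right mult.assoc flip: column)
  finally show ?thesis by (simp add: algebra_simps)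
qed

lemma psd_quadratic_form_unit:
  assumes "psd N \<rho>" "k < N"
  shows "quadratic_form N \<rho> (\<lambda>i. if i = k then 1 else 0) = \<rho> k k"
proof -
  have "quadratic_form N \<rho> (\<lambda>_. 0) = 0" by (simp add: quadratic_form_def)
  then show ?thesis using psd_quadratic_form_shift[OF assms, of 0 "\<lambda>_. 0" 1] by simp
qed

lemma psd_diagonal:
  assumes "psd N \<rho>" "k < N"
  shows "0 \<le> Re (\<rho> k k)" "\<rho> k k = of_real (Re (\<rho> k k))"
proof -
  show "0 \<le> Re (\<rho> k k)"
    using psd_quadratic_form[OF assms(1)] psd_quadratic_form_unit[OF assms] by metis
  show "\<rho> k k = of_real (Re (\<rho> k k))"
    using psd_hermitian[OF assms(1,2,2)] by (simp add: complex_eq_iff)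
qed

lemma psd_zero_diagonal:
  assumes psd: "psd N \<rho>" and "i < N" "k < N" and zero: "\<rho> k k = 0"
  shows "\<rho> k i = 0"
proof (rule ccontr)
  assume nonzero: "\<rho> k i \<noteq> 0"
  define s where "s = (Re (\<rho> i i) + 1) / (2 * (cmod (\<rho> k i))\<^sup>2)"
  define t where "t = - complex_of_real s * \<rho> k i"
  let ?v = "\<lambda>j. if j = i then 1 else 0 :: complex"
  have row: "\<rho> k i = (\<Sum>j<N. \<rho> k j * ?v j)"
    using \<open>i < N\<close> by (simp add: if_distrib[where f = "\<lambda>x. \<rho> k _ * x"] cong: if_cong)
  have "0 \<le> Re (quadratic_form N \<rho> (\<lambda>j. ?v j + (if j = k then t else 0)))"
    by (simp add: psd_quadratic_form[OF psd])
  also have "\<dots> = Re (\<rho> i i) - 2 * s * (cmod (\<rho> k i))\<^sup>2"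
    unfolding psd_quadratic_form_shift[OF psd \<open>k < N\<close> row] psd_quadratic_form_unit[OF psd \<open>i < N\<close>]
      cmod_power2
    by (simp add: t_def zero power2_eq_square algebra_simps)
  also have "\<dots> = - 1" using nonzero by (simp add: s_def field_simps)
  finally show False by simp
qed

definition schur_complement :: "nat \<Rightarrow> cmat \<Rightarrow> cmat" where
  "schur_complement k \<rho> i j = \<rho> i j - \<rho> i k * \<rho> k j / \<rho> k k"

lemma psd_schur_complement:
  assumes psd: "psd N \<rho>" and "k < N" and nonzero: "\<rho> k k \<noteq> 0"
  shows "psd N (schur_complement k \<rho>)"
  unfolding psd_def
proof (intro conjI allI impI)
  fix i j assume "i < N" "j < N"
  then show "schur_complement k \<rho> j i = cnj (schur_complement k \<rho> i j)"
    using psd \<open>k < N\<close> by (simp add: schur_complement_def psd_hermitian mult.commute)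
next
  fix v :: "nat \<Rightarrow> complex"
  define b where "b = (\<Sum>j<N. \<rho> k j * v j)"
  have column: "(\<Sum>i<N. cnj (v i) * \<rho> i k) = cnj b"
    unfolding b_def using psd \<open>k < N\<close> by (rule psd_column_sum)
  have "quadratic_form N (schur_complement k \<rho>) v = quadratic_form N \<rho> v
      - (\<Sum>i<N. \<Sum>j<N. (cnj (v i) * \<rho> i k) * (\<rho> k j * v j)) / \<rho> k k"
    by (simp add: quadratic_form_def schur_complement_def sum_subtractf sum_divide_distrib
        algebra_simps)
  also have "\<dots> = quadratic_form N \<rho> v - cnj b * b / \<rho> k k"
    by (simp add: column b_def flip: sum_product)
  also have "\<dots> = quadratic_form N \<rho> (\<lambda>i. v i + (if i = k then - b / \<rho> k k else 0))"
    unfolding psd_quadratic_form_shift[OF psd \<open>k < N\<close> b_def]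
    using psd_hermitian[OF psd \<open>k < N\<close> \<open>k < N\<close>] nonzero by (simp add: field_simps)
  finally show "0 \<le> Re (quadratic_form N (schur_complement k \<rho>) v)"
    by (simp add: psd_quadratic_form[OF psd])
qed

text \<open>Cholesky factorisation: passing to the Schur complement of a nonzero diagonal entry makes that
  entry vanish and keeps the other zeros on the diagonal.\<close>

lemma psd_imp_decomposition: "psd N \<rho> \<Longrightarrow> \<exists>L. is_decomposition N \<rho> L"
proof (induction "card {i. i < N \<and> \<rho> i i \<noteq> 0}" arbitrary: \<rho> rule: less_induct)
  case less
  note psd = \<open>psd N \<rho>\<close>
  show ?case
  proof (cases "\<exists>k<N. \<rho> k k \<noteq> 0")
    case False
    then have "is_decomposition N \<rho> []"
      using psd_zero_diagonal[OF psd] by (auto simp: is_decomposition_def)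
    then show ?thesis ..
  next
    case True
    then obtain k where k_less: "k < N" and nonzero: "\<rho> k k \<noteq> 0" by blast
    let ?\<sigma> = "schur_complement k \<rho>"
    have "?\<sigma> k k = 0" using nonzero by (simp add: schur_complement_def)
    moreover have "?\<sigma> i i = 0" if "i < N" "\<rho> i i = 0" for i
      using psd_zero_diagonal[OF psd k_less that(1,2)] that(2) by (simp add: schur_complement_def)
    ultimately have "{i. i < N \<and> ?\<sigma> i i \<noteq> 0} \<subset> {i. i < N \<and> \<rho> i i \<noteq> 0}"
      using k_less nonzero by blast
    then have "card {i. i < N \<and> ?\<sigma> i i \<noteq> 0} < card {i. i < N \<and> \<rho> i i \<noteq> 0}"
      by (intro psubset_card_mono) auto
    then obtain L where decomposition: "is_decomposition N ?\<sigma> L"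
      using less.hyps psd_schur_complement[of N \<rho> k] psd k_less nonzero by blast
    define v where "v = (\<lambda>i. \<rho> i k / of_real (sqrt (Re (\<rho> k k))))"
    have "outer v i j = \<rho> i k * \<rho> k j / \<rho> k k" if "j < N" for i j
    proof -
      have "complex_of_real (sqrt (Re (\<rho> k k))) * of_real (sqrt (Re (\<rho> k k))) = \<rho> k k"
        using psd_diagonal[OF psd k_less] by (simp flip: of_real_mult)
      then show ?thesis
        using psd_hermitian[OF psd that k_less] by (simp add: outer_def v_def)
    qed
    then have "is_decomposition N \<rho> (v # L)"
      using decomposition by (simp add: is_decomposition_def schur_complement_def algebra_simps)
    then show ?thesis ..
  qed
qed

section \<open>Two-qubit Gram matrices\<close>

definition mixed_gram_det :: "nat \<Rightarrow> cvec \<Rightarrow> cvec \<Rightarrow> cvec \<Rightarrow> cvec \<Rightarrow> real" where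
  "mixed_gram_det d x y z w
    = norm_sq d x * norm_sq d w + norm_sq d y * norm_sq d z - 2 * Re (cinner d x y * cinner d w z)"

lemma of_real_mixed_gram_det:
  "complex_of_real (mixed_gram_det d x y z w) = cinner d x x * cinner d w w
    + cinner d y y * cinner d z z - cinner d x y * cinner d w z - cinner d y x * cinner d z w"
proof -
  have "complex_of_real (2 * Re (cinner d x y * cinner d w z))
      = cinner d x y * cinner d w z + cinner d y x * cinner d z w"
    using complex_add_cnj[of "cinner d x y * cinner d w z"]
    by (simp only: complex_cnj_mult cnj_cinner)
  then show ?thesis by (simp add: mixed_gram_det_def cinner_self)
qed

definition gram_gap :: "nat \<Rightarrow> (nat \<Rightarrow> cvec) \<Rightarrow> real" where
  "gram_gap d V = mixed_gram_det d (V 0) (V 2) (V 1) (V 3)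
    - 2 * sqrt (gram_det d (V 0) (V 2)) * sqrt (gram_det d (V 1) (V 3))"

lemma gram_gap_cong:
  assumes gram: "\<And>i j. \<lbrakk>i < 4; j < 4; even i = even j\<rbrakk>
    \<Longrightarrow> cinner d (V i) (V j) = cinner d' (V' i) (V' j)"
  shows "gram_gap d V = gram_gap d' V'"
proof -
  have "complex_of_real (mixed_gram_det d (V 0) (V 2) (V 1) (V 3))
      = of_real (mixed_gram_det d' (V' 0) (V' 2) (V' 1) (V' 3))"
    by (simp add: of_real_mixed_gram_det gram)
  moreover have "gram_det d (V 0) (V 2) = gram_det d' (V' 0) (V' 2)"
    "gram_det d (V 1) (V 3) = gram_det d' (V' 1) (V' 3)"
    by (auto intro!: gram_det_eqI gram)
  ultimately show ?thesis by (simp only: gram_gap_def of_real_eq_iff)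
qed

lemma gram_det_double:
  "gram_det (2 * d) x y = gram_det d (block d x 0) (block d y 0)
    + gram_det d (block d x 1) (block d y 1)
    + mixed_gram_det d (block d x 0) (block d y 0) (block d x 1) (block d y 1)"
proof -
  have "complex_of_real (gram_det (2 * d) x y) = of_real (gram_det d (block d x 0) (block d y 0)
      + gram_det d (block d x 1) (block d y 1)
      + mixed_gram_det d (block d x 0) (block d y 0) (block d x 1) (block d y 1))"
    unfolding of_real_add of_real_gram_det of_real_mixed_gram_det cinner_block[of 2 d]
    by (simp add: numeral_2_eq_2 algebra_simps)
  then show ?thesis by (simp only: of_real_eq_iff)
qed

definition frobenius_sq :: "nat \<Rightarrow> cmat \<Rightarrow> real" where
  "frobenius_sq N n = (\<Sum>k<N. \<Sum>l<N. (cmod (n k l))\<^sup>2)"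

lemma mixed_gram_det_eq_frobenius_sq:
  "mixed_gram_det d x y z w = frobenius_sq d (\<lambda>k l. x k * w l - y k * z l)"
proof -
  have "complex_of_real (frobenius_sq d (\<lambda>k l. x k * w l - y k * z l))
      = (\<Sum>k<d. \<Sum>l<d. (x k * w l - y k * z l) * cnj (x k * w l - y k * z l))"
    by (simp only: frobenius_sq_def of_real_sum complex_norm_square)
  also have "\<dots> = of_real (mixed_gram_det d x y z w)"
    unfolding of_real_mixed_gram_det cinner_def sum_product
    by (simp add: sum.distrib sum_subtractf algebra_simps)
  finally show ?thesis by (simp only: of_real_eq_iff)
qed

subsection \<open>Rank two\<close>

definition bilinear_form :: "nat \<Rightarrow> cmat \<Rightarrow> cvec \<Rightarrow> cvec \<Rightarrow> complex" where
  "bilinear_form d n u v = (\<Sum>k<d. \<Sum>l<d. u k * n k l * v l)"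

definition perp :: "cvec \<Rightarrow> cvec" where
  "perp u = (\<lambda>k. if k = 0 then - cnj (u 1) else cnj (u 0))"

definition det2 :: "cmat \<Rightarrow> complex" where
  "det2 n = n 0 0 * n 1 1 - n 0 1 * n 1 0"

lemma unimodular_mult_cnj: "cmod z = 1 \<Longrightarrow> z * cnj z = 1"
  using complex_norm_square[of z] by simp

lemma perp_resolution:
  assumes "cinner 2 u u = 1" "k < 2" "l < 2"
  shows "u k * cnj (u l) + perp u k * cnj (perp u l) = (if k = l then 1 else 0)"
proof -
  have "u 0 * cnj (u 0) + u 1 * cnj (u 1) = 1"
    using assms(1) by (simp add: cinner_def numeral_2_eq_2)
  then show ?thesis
    using assms(2,3) by (auto simp: less_2_cases_iff perp_def algebra_simps)
qed

lemma bilinear_form_rotate: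
  fixes n u
  assumes unit: "cinner 2 u u = 1"
  defines "b \<equiv> bilinear_form 2 n"
  shows "(cmod (b u u))\<^sup>2 + (cmod (b u (perp u)))\<^sup>2 + (cmod (b (perp u) u))\<^sup>2
      + (cmod (b (perp u) (perp u)))\<^sup>2 = frobenius_sq 2 n"
    and "b u u * b (perp u) (perp u) - b u (perp u) * b (perp u) u = det2 n"
proof -
  have "complex_of_real ((cmod (b u u))\<^sup>2 + (cmod (b u (perp u)))\<^sup>2 + (cmod (b (perp u) u))\<^sup>2
      + (cmod (b (perp u) (perp u)))\<^sup>2) = (cinner 2 u u)\<^sup>2 * of_real (frobenius_sq 2 n)"
    unfolding of_real_add of_real_sum complex_norm_square b_def
      frobenius_sq_def bilinear_form_def cinner_def perp_def
    by (simp add: numeral_2_eq_2 algebra_simps)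
  then show "(cmod (b u u))\<^sup>2 + (cmod (b u (perp u)))\<^sup>2 + (cmod (b (perp u) u))\<^sup>2
      + (cmod (b (perp u) (perp u)))\<^sup>2 = frobenius_sq 2 n"
    by (simp only: unit power_one mult_1_left of_real_eq_iff)
  have "b u u * b (perp u) (perp u) - b u (perp u) * b (perp u) u = (cinner 2 u u)\<^sup>2 * det2 n"
    unfolding b_def det2_def bilinear_form_def cinner_def perp_def
    by (simp add: numeral_2_eq_2 algebra_simps)
  then show "b u u * b (perp u) (perp u) - b u (perp u) * b (perp u) u = det2 n"
    by (simp add: unit)
qed

lemma isotropic_unit_vector:
  obtains u where "cinner 2 u u = 1" "bilinear_form 2 n u u = 0"
proof (cases "n 0 0 = 0")
  case True
  show ?thesis
    by (rule that[of "\<lambda>k. if k = 0 then 1 else 0"])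
      (simp_all add: True cinner_def bilinear_form_def numeral_2_eq_2)
next
  case False
  define h where "h = csqrt ((n 0 1 + n 1 0)\<^sup>2 - 4 * n 0 0 * n 1 1)"
  define z where "z = (- (n 0 1 + n 1 0) + h) / (2 * n 0 0)"
  have "h\<^sup>2 = (n 0 1 + n 1 0)\<^sup>2 - 4 * n 0 0 * n 1 1" by (simp add: h_def)
  then have root: "n 0 0 * z\<^sup>2 + (n 0 1 + n 1 0) * z + n 1 1 = 0"
    using False by (simp add: z_def field_simps power2_eq_square) algebra
  define s where "s = complex_of_real (1 / sqrt (1 + (cmod z)\<^sup>2))"
  have "s * s * of_real (1 + (cmod z)\<^sup>2) = 1"
    by (simp add: s_def add_nonneg_eq_0_iff flip: of_real_mult of_real_add of_real_power)
  then have "s * s * (1 + z * cnj z) = 1"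
    by (simp only: of_real_add of_real_1 complex_norm_square)
  moreover have "cnj s = s" by (simp add: s_def)
  ultimately have "cinner 2 (\<lambda>k. if k = 0 then s * z else s) (\<lambda>k. if k = 0 then s * z else s) = 1"
    by (simp add: cinner_def numeral_2_eq_2 algebra_simps)
  moreover have "bilinear_form 2 n (\<lambda>k. if k = 0 then s * z else s) (\<lambda>k. if k = 0 then s * z else s)
      = s\<^sup>2 * (n 0 0 * z\<^sup>2 + (n 0 1 + n 1 0) * z + n 1 1)"
    by (simp add: bilinear_form_def numeral_2_eq_2 algebra_simps)
  ultimately show ?thesis using that root by simp
qed

text \<open>In a rotated basis whose first vector is isotropic the form has the matrix
  \<open>(0, m\<^sub>0\<^sub>1; m\<^sub>1\<^sub>0, m\<^sub>1\<^sub>1)\<close>, where \<open>|m\<^sub>1\<^sub>1|\<^sup>2 = |n|\<^sup>2 - |m\<^sub>0\<^sub>1|\<^sup>2 - |m\<^sub>1\<^sub>0|\<^sup>2 \<le> |n|\<^sup>2 - 2 |m\<^sub>0\<^sub>1 m\<^sub>1\<^sub>0|\<close>.\<close>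

lemma isotropic_basis:
  obtains u where "cinner 2 u u = 1" "bilinear_form 2 n u u = 0"
    "(cmod (bilinear_form 2 n (perp u) (perp u)))\<^sup>2 \<le> frobenius_sq 2 n - 2 * cmod (det2 n)"
proof -
  obtain u where unit: "cinner 2 u u = 1" and isotropic: "bilinear_form 2 n u u = 0"
    by (rule isotropic_unit_vector)
  let ?b = "bilinear_form 2 n"
  have "cmod (det2 n) = cmod (?b u (perp u)) * cmod (?b (perp u) u)"
    using bilinear_form_rotate(2)[OF unit, of n, symmetric] isotropic by (simp add: norm_mult)
  then have "2 * cmod (det2 n) \<le> (cmod (?b u (perp u)))\<^sup>2 + (cmod (?b (perp u) u))\<^sup>2"
    using sum_squares_bound[of "cmod (?b u (perp u))" "cmod (?b (perp u) u)"] by simp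
  then have "(cmod (?b (perp u) (perp u)))\<^sup>2 \<le> frobenius_sq 2 n - 2 * cmod (det2 n)"
    using bilinear_form_rotate(1)[OF unit, of n] isotropic by simp
  then show ?thesis using that unit isotropic by blast
qed

lemma conc_vec_two_qubits: "conc_vec 2 2 \<phi> = 2 * cmod (\<phi> 0 * \<phi> 3 - \<phi> 2 * \<phi> 1)"
  unfolding conc_vec_qubit gram_det_2
  by (simp add: block_def numeral_2_eq_2 numeral_3_eq_3 mult.commute)

lemma ensemble_conc_le_gram_2:
  fixes V :: "nat \<Rightarrow> cvec"
  shows "ensemble_conc_le 2 2 (\<lambda>i j. cinner 2 (V i) (V j)) (2 * sqrt (gram_gap 2 V))"
proof -
  define n where "n = (\<lambda>k l. V 0 k * V 3 l - V 2 k * V 1 l)"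
  obtain u where unit: "cinner 2 u u = 1" and isotropic: "bilinear_form 2 n u u = 0"
    and bound: "(cmod (bilinear_form 2 n (perp u) (perp u)))\<^sup>2
      \<le> frobenius_sq 2 n - 2 * cmod (det2 n)"
    by (rule isotropic_basis)
  define \<phi> where "\<phi> = (\<lambda>u i. \<Sum>k<2. V i k * u k)"
  have conc: "conc_vec 2 2 (\<phi> v) = 2 * cmod (bilinear_form 2 n v v)" for v
  proof -
    have "\<phi> v 0 * \<phi> v 3 - \<phi> v 2 * \<phi> v 1 = bilinear_form 2 n v v"
      by (simp add: \<phi>_def bilinear_form_def n_def numeral_2_eq_2 algebra_simps)
    then show ?thesis by (simp only: conc_vec_two_qubits)
  qed
  have "outer (\<phi> u) i j + outer (\<phi> (perp u)) i j
      = (\<Sum>k<2. \<Sum>l<2. V i k * cnj (V j l) * (u k * cnj (u l) + perp u k * cnj (perp u l)))" for i j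
    by (simp add: outer_def \<phi>_def numeral_2_eq_2 algebra_simps)
  then have "outer (\<phi> u) i j + outer (\<phi> (perp u)) i j = cinner 2 (V i) (V j)" for i j
    using perp_resolution[OF unit] by (simp add: cinner_def numeral_2_eq_2)
  then have "is_decomposition (2 * 2) (\<lambda>i j. cinner 2 (V i) (V j)) [\<phi> u, \<phi> (perp u)]"
    by (simp add: is_decomposition_def)
  moreover have "(cmod (bilinear_form 2 n (perp u) (perp u)))\<^sup>2 \<le> gram_gap 2 V"
  proof -
    have "det2 n = (V 0 0 * V 2 1 - V 0 1 * V 2 0) * (V 1 0 * V 3 1 - V 1 1 * V 3 0)"
      by (simp add: det2_def n_def algebra_simps)
    then have "cmod (det2 n) = sqrt (gram_det 2 (V 0) (V 2)) * sqrt (gram_det 2 (V 1) (V 3))"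
      by (simp add: gram_det_2 norm_mult)
    then show ?thesis using bound by (simp add: gram_gap_def mixed_gram_det_eq_frobenius_sq n_def)
  qed
  then have "(\<Sum>v\<leftarrow>[\<phi> u, \<phi> (perp u)]. conc_vec 2 2 v) \<le> 2 * sqrt (gram_gap 2 V)"
    by (simp add: conc isotropic real_le_rsqrt)
  ultimately show ?thesis by (rule ensemble_conc_leI)
qed

subsection \<open>Contractions as convex combinations of unitary matrices\<close>

definition unitary :: "nat \<Rightarrow> cmat \<Rightarrow> bool" where
  "unitary N U \<longleftrightarrow> (\<forall>i<N. \<forall>j<N. (\<Sum>k<N. cnj (U k i) * U k j) = (if i = j then 1 else 0))"

lemma unitary_uminus: "unitary N U \<Longrightarrow> unitary N (\<lambda>k l. - U k l)"
  by (simp add: unitary_def)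

lemma cinner_unitary:
  assumes "unitary N U"
  shows "cinner N (\<lambda>k. \<Sum>l<N. cnj (U k l) * x l) (\<lambda>k. \<Sum>l<N. cnj (U k l) * y l) = cinner N x y"
proof -
  have "cinner N (\<lambda>k. \<Sum>l<N. cnj (U k l) * x l) (\<lambda>k. \<Sum>l<N. cnj (U k l) * y l)
      = (\<Sum>k<N. \<Sum>l<N. \<Sum>m<N. x l * cnj (y m) * (cnj (U k l) * U k m))"
    by (simp add: cinner_def sum_product mult_ac)
  also have "\<dots> = (\<Sum>l<N. \<Sum>k<N. \<Sum>m<N. x l * cnj (y m) * (cnj (U k l) * U k m))"
    by (rule sum.swap)
  also have "\<dots> = (\<Sum>l<N. \<Sum>m<N. \<Sum>k<N. x l * cnj (y m) * (cnj (U k l) * U k m))"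
    by (intro sum.cong refl sum.swap)
  also have "\<dots> = (\<Sum>l<N. \<Sum>m<N. x l * cnj (y m) * (if l = m then 1 else 0))"
    using assms by (simp add: unitary_def flip: sum_distrib_left)
  also have "\<dots> = cinner N x y"
    by (simp add: cinner_def if_distrib[where f = "\<lambda>t. _ * t"] cong: if_cong)
  finally show ?thesis .
qed

text \<open>For \<open>z = 1\<close> these are the quaternions, the real multiples of the matrices in \<open>SU(2)\<close>.\<close>

definition quaternion_matrix :: "complex \<Rightarrow> complex \<Rightarrow> complex \<Rightarrow> cmat" where
  "quaternion_matrix z a b = (\<lambda>k l. if k = 0 then if l = 0 then a else b
     else if l = 0 then - (z * cnj b) else z * cnj a)"

lemma unitary_quaternion_matrix:
  assumes "cmod z = 1" "(cmod a)\<^sup>2 + (cmod b)\<^sup>2 = 1"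
  shows "unitary 2 (quaternion_matrix z a b)"
proof -
  have "z * cnj z = 1" using assms(1) by (rule unimodular_mult_cnj)
  moreover have "a * cnj a + b * cnj b = 1"
    using arg_cong[OF assms(2), of complex_of_real]
    by (simp only: of_real_add complex_norm_square of_real_1)
  ultimately show ?thesis
    unfolding unitary_def less_2_cases_iff quaternion_matrix_def
    by (auto simp: numeral_2_eq_2) algebra+
qed

lemma quaternion_matrix_polar:
  assumes "cmod z = 1"
  obtains U where "unitary 2 U"
    "\<And>k l. quaternion_matrix z a b k l = of_real (sqrt ((cmod a)\<^sup>2 + (cmod b)\<^sup>2)) * U k l"
proof (cases "(cmod a)\<^sup>2 + (cmod b)\<^sup>2 = 0")
  case True
  then have "a = 0" "b = 0" by (simp_all add: sum_power2_eq_zero_iff)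
  then have "quaternion_matrix z a b k l = of_real (sqrt ((cmod a)\<^sup>2 + (cmod b)\<^sup>2))
      * quaternion_matrix z 1 0 k l" for k l
    by (simp add: quaternion_matrix_def)
  then show ?thesis using that unitary_quaternion_matrix[OF assms, of 1 0] by simp
next
  case False
  let ?n = "(cmod a)\<^sup>2 + (cmod b)\<^sup>2"
  let ?r = "sqrt ?n"
  have radius: "?r \<noteq> 0" using False by simp
  have "(cmod (a / ?r))\<^sup>2 + (cmod (b / ?r))\<^sup>2 = ?n / ?n"
    by (simp add: norm_divide power_divide flip: add_divide_distrib)
  then have "unitary 2 (quaternion_matrix z (a / ?r) (b / ?r))"
    using False by (intro unitary_quaternion_matrix assms) simp
  moreover have "quaternion_matrix z a b k l
      = of_real ?r * quaternion_matrix z (a / ?r) (b / ?r) k l" for k l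
    using radius by (simp add: quaternion_matrix_def del: real_sqrt_eq_0_iff)
  ultimately show ?thesis using that by blast
qed

definition quaternion_part :: "complex \<Rightarrow> cmat \<Rightarrow> cmat" where
  "quaternion_part z W
    = quaternion_matrix z ((W 0 0 + z * cnj (W 1 1)) / 2) ((W 0 1 - z * cnj (W 1 0)) / 2)"

lemma quaternion_part_decomposition:
  assumes "cmod z = 1" "k < 2" "l < 2"
  shows "W k l = quaternion_part z W k l + quaternion_part (- z) W k l"
proof -
  have "z * cnj z = 1" using assms(1) by (rule unimodular_mult_cnj)
  then have "z * (cnj z * w) = w" for w by (simp flip: mult.assoc)
  then show ?thesis
    using assms(2,3)
    by (auto simp: quaternion_part_def quaternion_matrix_def less_2_cases_iff field_simps)
qed

lemma quaternion_part_polar: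
  assumes "cmod z = 1"
  obtains U where "unitary 2 U" "0 \<le> frobenius_sq 2 W + 2 * Re (cnj z * det2 W)"
    "\<And>k l. quaternion_part z W k l
      = of_real (sqrt ((frobenius_sq 2 W + 2 * Re (cnj z * det2 W)) / 4)) * U k l"
proof -
  let ?a = "(W 0 0 + z * cnj (W 1 1)) / 2" and ?b = "(W 0 1 - z * cnj (W 1 0)) / 2"
  have unimodular: "z * cnj z = 1" using assms by (rule unimodular_mult_cnj)
  have "complex_of_real (((cmod ?a)\<^sup>2 + (cmod ?b)\<^sup>2) * 4) = (?a * cnj ?a + ?b * cnj ?b) * 4"
    by (simp only: of_real_mult of_real_add complex_norm_square of_real_numeral)
  also have "\<dots> = W 0 0 * cnj (W 0 0) + W 0 1 * cnj (W 0 1) + W 1 0 * cnj (W 1 0)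
      + W 1 1 * cnj (W 1 1) + (cnj z * det2 W + cnj (cnj z * det2 W))"
    unfolding det2_def using unimodular by simp algebra
  also have "\<dots> = of_real (frobenius_sq 2 W + 2 * Re (cnj z * det2 W))"
    unfolding complex_add_cnj frobenius_sq_def of_real_add of_real_sum complex_norm_square
    by (simp add: numeral_2_eq_2)
  finally have "((cmod ?a)\<^sup>2 + (cmod ?b)\<^sup>2) * 4 = frobenius_sq 2 W + 2 * Re (cnj z * det2 W)"
    by (simp only: of_real_eq_iff)
  then have size: "(cmod ?a)\<^sup>2 + (cmod ?b)\<^sup>2 = (frobenius_sq 2 W + 2 * Re (cnj z * det2 W)) / 4"
    by (rule eq_divide_imp[rotated]) simp
  obtain U where unitary: "unitary 2 U"
    and polar: "\<And>k l. quaternion_matrix z ?a ?b k l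
      = of_real (sqrt ((cmod ?a)\<^sup>2 + (cmod ?b)\<^sup>2)) * U k l"
    by (rule quaternion_matrix_polar[OF assms, of ?a ?b]) (rule that)
  show ?thesis
  proof (rule that[OF unitary])
    have "0 \<le> (cmod ?a)\<^sup>2 + (cmod ?b)\<^sup>2" by simp
    then show "0 \<le> frobenius_sq 2 W + 2 * Re (cnj z * det2 W)" unfolding size by simp
    show "quaternion_part z W k l
        = of_real (sqrt ((frobenius_sq 2 W + 2 * Re (cnj z * det2 W)) / 4)) * U k l" for k l
      using polar unfolding quaternion_part_def size .
  qed
qed

lemma sqrt_add_sqrt_le_1:
  fixes F D :: real
  assumes "0 \<le> F + 2 * D" "0 \<le> F - 2 * D" "F \<le> 2" "F \<le> 1 + D\<^sup>2"
  shows "sqrt ((F + 2 * D) / 4) + sqrt ((F - 2 * D) / 4) \<le> 1"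
proof -
  let ?r = "sqrt ((F + 2 * D) / 4)" and ?s = "sqrt ((F - 2 * D) / 4)"
  have "(F + 2 * D) * (F - 2 * D) \<le> (2 - F)\<^sup>2"
    using assms(4) by (simp add: power2_eq_square algebra_simps)
  then have "?r * ?s \<le> sqrt (((2 - F) / 4)\<^sup>2)"
    by (simp add: power_divide flip: real_sqrt_mult)
  also have "\<dots> = (2 - F) / 4" using assms(3) by simp
  finally have "(?r + ?s)\<^sup>2 \<le> 1" using assms(1,2) by (simp add: power2_sum field_simps)
  then show ?thesis by (simp add: abs_square_le_1 abs_le_iff)
qed

text \<open>The hypotheses express that the trace and the determinant of \<open>1 - W\<^sup>* W\<close> are nonnegative.
  The phase \<open>z\<close> of the determinant makes the sizes of the two quaternion parts equal to half the sum
  and half the difference of the singular values of \<open>W\<close>.\<close>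

lemma contraction_convex_unitary:
  assumes "frobenius_sq 2 W \<le> 2" "frobenius_sq 2 W \<le> 1 + (cmod (det2 W))\<^sup>2"
  obtains p q t :: real and U V T where "0 \<le> p" "0 \<le> q" "0 \<le> t" "p + q + t = 1"
    "unitary 2 U" "unitary 2 V" "unitary 2 T"
    "\<And>k l. \<lbrakk>k < 2; l < 2\<rbrakk> \<Longrightarrow> W k l = of_real p * U k l + of_real q * V k l + of_real t * T k l"
proof -
  define z where "z = cis (Arg (det2 W))"
  have unimodular: "cmod z = 1" "cmod (- z) = 1" by (simp_all add: z_def)
  have "det2 W = of_real (cmod (det2 W)) * z"
    using rcis_cmod_Arg[of "det2 W"] by (simp add: z_def rcis_def)
  moreover have "z * cnj z = 1" using unimodular(1) by (rule unimodular_mult_cnj)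
  ultimately have "cnj z * det2 W = of_real (cmod (det2 W))" by algebra
  then have det: "Re (cnj z * det2 W) = cmod (det2 W)" "Re (cnj (- z) * det2 W) = - cmod (det2 W)"
    by simp_all
  let ?F = "frobenius_sq 2 W" and ?D = "cmod (det2 W)"
  define r s where "r = sqrt ((?F + 2 * ?D) / 4)" and "s = sqrt ((?F - 2 * ?D) / 4)"
  obtain U where U_unitary: "unitary 2 U" and sum_nonneg: "0 \<le> ?F + 2 * ?D"
    and U_part: "\<And>k l. quaternion_part z W k l = of_real r * U k l"
    using quaternion_part_polar[OF unimodular(1), of W] unfolding det r_def by blast
  obtain V where V_unitary: "unitary 2 V" and diff_nonneg: "0 \<le> ?F - 2 * ?D"
    and V_part: "\<And>k l. quaternion_part (- z) W k l = of_real s * V k l"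
    using quaternion_part_polar[OF unimodular(2), of W] unfolding det s_def by auto
  have sizes: "0 \<le> r" "0 \<le> s" "r + s \<le> 1"
    using sum_nonneg diff_nonneg sqrt_add_sqrt_le_1[OF sum_nonneg diff_nonneg assms]
    by (simp_all add: r_def s_def)
  define t where "t = (1 - r - s) / 2"
  show ?thesis
  proof (rule that[of "r + t" s t U V "\<lambda>k l. - U k l"])
    show "0 \<le> r + t" "0 \<le> s" "0 \<le> t" "r + t + s + t = 1"
      using sizes by (simp_all add: t_def field_simps)
    show "unitary 2 U" "unitary 2 V" "unitary 2 (\<lambda>k l. - U k l)"
      using U_unitary V_unitary by (simp_all add: unitary_uminus)
    show "W k l = of_real (r + t) * U k l + of_real s * V k l + of_real t * (- U k l)"
      if "k < 2" "l < 2" for k l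
      by (subst quaternion_part_decomposition[OF unimodular(1) that])
        (simp add: U_part V_part algebra_simps)
  qed
qed

lemma suborthonormal_cross_contraction:
  assumes sub_e: "suborthonormal d 2 e" and sub_f: "suborthonormal d 2 f"
  defines "W \<equiv> \<lambda>k l. cinner d (e k) (f l)"
  shows "frobenius_sq 2 W \<le> 2" "frobenius_sq 2 W \<le> 1 + (cmod (det2 W))\<^sup>2"
proof -
  define r where "r = (\<lambda>l. residual d 2 e (f l))"
  define w where "w = (\<lambda>l k. W k l)"
  have gram: "cinner d (r l) (r m) = cinner d (f l) (f m) - cinner 2 (w m) (w l)" for l m
    by (simp add: r_def cinner_residual_residual[OF sub_e] cinner_def[of 2] w_def W_def cnj_cinner
        mult.commute)
  have column: "norm_sq d (r l) = norm_sq d (f l) - norm_sq 2 (w l)" for l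
    using gram[of l l] by (simp add: cinner_self flip: of_real_diff)
  have f_le: "norm_sq d (f l) \<le> 1" if "l < 2" for l
    using sub_f that by (fastforce simp: suborthonormal_def)
  have bounds: "norm_sq 2 (w l) \<le> norm_sq d (f l)" for l
    using column[of l] norm_sq_nonneg[of d "r l"] by simp
  have frob: "frobenius_sq 2 W = norm_sq 2 (w 0) + norm_sq 2 (w 1)"
    by (simp add: frobenius_sq_def norm_sq_def w_def numeral_2_eq_2)
  then show "frobenius_sq 2 W \<le> 2"
    using bounds[of 0] bounds[of 1] f_le[of 0] f_le[of 1] by simp
  have "cinner d (r 0) (r 1) = - cinner 2 (w 1) (w 0)"
    using sub_f by (simp add: gram suborthonormal_def)
  then have "cmod (cinner d (r 0) (r 1)) = cmod (cinner 2 (w 0) (w 1))"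
    by (metis norm_minus_cancel cnj_cinner complex_mod_cnj)
  then have "(cmod (cinner 2 (w 0) (w 1)))\<^sup>2 \<le> norm_sq d (r 0) * norm_sq d (r 1)"
    using gram_det_nonneg[of d "r 0" "r 1"] by (simp add: gram_det_def)
  also have "\<dots> \<le> (1 - norm_sq 2 (w 0)) * (1 - norm_sq 2 (w 1))"
    unfolding column using bounds f_le by (intro mult_mono) (simp_all add: order_trans[OF bounds])
  finally have "(cmod (cinner 2 (w 0) (w 1)))\<^sup>2
      \<le> 1 - frobenius_sq 2 W + norm_sq 2 (w 0) * norm_sq 2 (w 1)"
    by (simp add: frob algebra_simps)
  moreover have "norm_sq 2 (w 0) * norm_sq 2 (w 1) - (cmod (cinner 2 (w 0) (w 1)))\<^sup>2
      = (cmod (det2 W))\<^sup>2"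
    using gram_det_2[of "w 0" "w 1"] by (simp add: gram_det_def w_def det2_def mult.commute)
  ultimately show "frobenius_sq 2 W \<le> 1 + (cmod (det2 W))\<^sup>2" by simp
qed

subsection \<open>Arbitrary rank\<close>

text \<open>The Gram matrix of vectors with coordinates \<open>x i\<close> in one orthonormal system for even \<open>i\<close> and in
  another for odd \<open>i\<close>, where \<open>W\<close> is the matrix of inner products between the systems.\<close>

definition coupled_gram :: "nat \<Rightarrow> cmat \<Rightarrow> (nat \<Rightarrow> cvec) \<Rightarrow> cmat" where
  "coupled_gram d W x i j =
     (if even i = even j then cinner d (x i) (x j)
      else if even i then sesquilinear_form d W (x i) (x j)
      else cnj (sesquilinear_form d W (x j) (x i)))"

definition rotate_odd :: "nat \<Rightarrow> cmat \<Rightarrow> (nat \<Rightarrow> cvec) \<Rightarrow> nat \<Rightarrow> cvec" where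
  "rotate_odd d U x i = (if even i then x i else (\<lambda>k. \<Sum>l<d. cnj (U k l) * x i l))"

lemma coupled_gram_unitary:
  assumes "unitary d U"
  shows "coupled_gram d U x i j = cinner d (rotate_odd d U x i) (rotate_odd d U x j)"
proof -
  let ?y = "rotate_odd d U x"
  have cross: "cinner d (?y i) (?y j) = sesquilinear_form d U (x i) (x j)"
    if "even i" "odd j" for i j
    using that
    by (simp add: rotate_odd_def cinner_def sesquilinear_form_def sum_distrib_left mult.assoc)
  consider (same) "even i = even j" | (even_odd) "even i" "odd j" | (odd_even) "odd i" "even j"
    by blast
  then show ?thesis
  proof cases
    case same
    then show ?thesis using assms by (simp add: coupled_gram_def rotate_odd_def cinner_unitary)
  next
    case even_odd
    then show ?thesis by (simp add: coupled_gram_def cross)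
  next
    case odd_even
    then show ?thesis by (simp add: coupled_gram_def cross[symmetric] cnj_cinner)
  qed
qed

lemma coupled_gram_convex:
  fixes p q t :: real
  assumes "p + q + t = 1"
    and combination: "\<And>k l. \<lbrakk>k < d; l < d\<rbrakk>
      \<Longrightarrow> W k l = of_real p * U k l + of_real q * V k l + of_real t * T k l"
  shows "coupled_gram d W x i j = of_real p * coupled_gram d U x i j
    + of_real q * coupled_gram d V x i j + of_real t * coupled_gram d T x i j"
proof -
  have "sesquilinear_form d W a b = of_real p * sesquilinear_form d U a b
      + of_real q * sesquilinear_form d V a b + of_real t * sesquilinear_form d T a b" for a b
    by (simp add: sesquilinear_form_def combination sum_distrib_left sum.distrib algebra_simps)
  moreover have "c = of_real p * c + of_real q * c + of_real t * c" for c :: complex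
    using assms(1) by (simp flip: distrib_right of_real_add)
  ultimately show ?thesis by (simp add: coupled_gram_def)
qed

lemma ensemble_conc_le_coupled_gram_unitary:
  assumes "unitary 2 U"
  shows "ensemble_conc_le 2 2 (coupled_gram 2 U x) (2 * sqrt (gram_gap 2 x))"
proof -
  have "gram_gap 2 (rotate_odd 2 U x) = gram_gap 2 x"
    using assms by (intro gram_gap_cong) (auto simp: rotate_odd_def cinner_unitary)
  moreover have "coupled_gram 2 U x
      = (\<lambda>i j. cinner 2 (rotate_odd 2 U x i) (rotate_odd 2 U x j))"
    by (intro ext coupled_gram_unitary assms)
  ultimately show ?thesis using ensemble_conc_le_gram_2[of "rotate_odd 2 U x"] by simp
qed

lemma ensemble_conc_le_coupled_gram:
  assumes "frobenius_sq 2 W \<le> 2" "frobenius_sq 2 W \<le> 1 + (cmod (det2 W))\<^sup>2"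
  shows "ensemble_conc_le 2 2 (coupled_gram 2 W x) (2 * sqrt (gram_gap 2 x))"
proof -
  obtain p q t :: real and U V T where weights: "0 \<le> p" "0 \<le> q" "0 \<le> t" "p + q + t = 1"
    and unitary: "unitary 2 U" "unitary 2 V" "unitary 2 T"
    and combination: "\<And>k l. \<lbrakk>k < 2; l < 2\<rbrakk>
      \<Longrightarrow> W k l = of_real p * U k l + of_real q * V k l + of_real t * T k l"
    using contraction_convex_unitary[OF assms] by metis
  let ?\<kappa> = "2 * sqrt (gram_gap 2 x)"
  have "coupled_gram 2 W x = (\<lambda>i j. of_real p * coupled_gram 2 U x i j
      + of_real q * coupled_gram 2 V x i j + of_real t * coupled_gram 2 T x i j)"
    using weights(4) combination by (intro ext coupled_gram_convex)
  then have "ensemble_conc_le 2 2 (coupled_gram 2 W x) (p * ?\<kappa> + q * ?\<kappa> + t * ?\<kappa>)"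
    using unitary weights
    by (simp add: ensemble_conc_le_add ensemble_conc_le_scale ensemble_conc_le_coupled_gram_unitary)
  then show ?thesis using weights(4) by (simp flip: distrib_right)
qed

lemma Gram_Schmidt_parity:
  fixes V :: "nat \<Rightarrow> cvec"
  obtains e f where "suborthonormal d n e" "suborthonormal d n f"
    "\<And>i. i < 2 * n \<Longrightarrow> expands d n (if even i then e else f) (V i)"
proof -
  obtain e where sub_e: "suborthonormal d n e"
    and expand_even: "\<And>k. k < n \<Longrightarrow> expands d n e (V (2 * k))"
    using Gram_Schmidt[of d n "\<lambda>k. V (2 * k)"] by blast
  obtain f where sub_f: "suborthonormal d n f"
    and expand_odd: "\<And>k. k < n \<Longrightarrow> expands d n f (V (2 * k + 1))"
    using Gram_Schmidt[of d n "\<lambda>k. V (2 * k + 1)"] by blast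
  have "expands d n (if even i then e else f) (V i)" if "i < 2 * n" for i
    using expand_even[of "i div 2"] expand_odd[of "i div 2"] that by (cases "even i") auto
  then show ?thesis using that sub_e sub_f by blast
qed

lemma cinner_eq_coupled_gram:
  fixes d :: nat and V e f :: "nat \<Rightarrow> cvec"
  defines "x \<equiv> \<lambda>i k. cinner d (V i) (if even i then e k else f k)"
  assumes "expands d n (if even i then e else f) (V i)" "expands d n (if even j then e else f) (V j)"
  shows "cinner d (V i) (V j) = coupled_gram n (\<lambda>k l. cinner d (e k) (f l)) x i j"
proof -
  consider (same) "even i = even j" | (even_odd) "even i" "odd j" | (odd_even) "odd i" "even j"
    by blast
  then show ?thesis
  proof cases
    case same
    then show ?thesis
      using expands_Parseval[OF assms(2), of "V j"]
      by (cases "even i") (simp_all add: coupled_gram_def x_def)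
  next
    case even_odd
    then show ?thesis
      using expands_cinner_cross[of d n e "V i" f "V j"] assms(2,3)
      by (simp add: coupled_gram_def x_def)
  next
    case odd_even
    then have "cnj (cinner d (V j) (V i)) = coupled_gram n (\<lambda>k l. cinner d (e k) (f l)) x i j"
      using expands_cinner_cross[of d n e "V j" f "V i"] assms(2,3)
      by (simp add: coupled_gram_def x_def)
    then show ?thesis by (simp add: cnj_cinner)
  qed
qed

lemma ensemble_conc_le_gram:
  fixes V :: "nat \<Rightarrow> cvec"
  shows "ensemble_conc_le 2 2 (\<lambda>i j. cinner d (V i) (V j)) (2 * sqrt (gram_gap d V))"
proof -
  obtain e f where sub_e: "suborthonormal d 2 e" and sub_f: "suborthonormal d 2 f"
    and expands: "\<And>i. i < 2 * 2 \<Longrightarrow> expands d 2 (if even i then e else f) (V i)"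
    by (rule Gram_Schmidt_parity[where d = d and n = 2 and V = V]) (rule that)
  define W where "W = (\<lambda>k l. cinner d (e k) (f l))"
  define x where "x = (\<lambda>i k. cinner d (V i) (if even i then e k else f k))"
  have gram: "cinner d (V i) (V j) = coupled_gram 2 W x i j" if "i < 2 * 2" "j < 2 * 2" for i j
    unfolding W_def x_def using that by (intro cinner_eq_coupled_gram expands)
  then have "gram_gap d V = gram_gap 2 x"
    by (intro gram_gap_cong) (simp add: coupled_gram_def)
  moreover have "ensemble_conc_le 2 2 (\<lambda>i j. cinner d (V i) (V j)) \<kappa>
      \<longleftrightarrow> ensemble_conc_le 2 2 (coupled_gram 2 W x) \<kappa>" for \<kappa>
    by (rule ensemble_conc_le_cong) (rule gram)
  moreover have "frobenius_sq 2 W \<le> 2" "frobenius_sq 2 W \<le> 1 + (cmod (det2 W))\<^sup>2"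
    using suborthonormal_cross_contraction[OF sub_e sub_f] by (simp_all add: W_def)
  ultimately show ?thesis using ensemble_conc_le_coupled_gram by simp
qed

section \<open>Monogamy of the squared concurrence\<close>

lemma ptrace_last_outer: "ptrace_last d (outer \<psi>) i j = cinner d (block d \<psi> i) (block d \<psi> j)"
  by (simp add: ptrace_last_def outer_def cinner_def block_def)

lemma ptrace_last_add:
  "ptrace_last d (\<lambda>i j. \<rho> i j + \<sigma> i j) = (\<lambda>i j. ptrace_last d \<rho> i j + ptrace_last d \<sigma> i j)"
  by (simp add: ptrace_last_def sum.distrib fun_eq_iff)

lemma ptrace_last_eq_0:
  assumes "\<And>i j. \<lbrakk>i < N * d; j < N * d\<rbrakk> \<Longrightarrow> \<rho> i j = 0" "a < N" "b < N"
  shows "ptrace_last d \<rho> a b = 0"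
  unfolding ptrace_last_def using assms
  by (intro sum.neutral ballI assms(1) mult_add_less_mult) auto

lemma trace_ptrace_last: "trace N (ptrace_last d \<rho>) = trace (N * d) \<rho>"
  by (simp add: trace_def ptrace_last_def sum_lessThan_mult)

definition mid_slice :: "nat \<Rightarrow> nat \<Rightarrow> cvec \<Rightarrow> nat \<Rightarrow> cvec" where
  "mid_slice m d \<psi> k = (\<lambda>i. \<psi> (i div d * (m * d) + k * d + i mod d))"

lemma ptrace_mid_outer: "ptrace_mid m d (outer \<psi>) i j = (\<Sum>k<m. outer (mid_slice m d \<psi> k) i j)"
  by (simp add: ptrace_mid_def outer_def mid_slice_def)

lemma block_mid_slice: "c < d \<Longrightarrow> block d (mid_slice m d \<psi> k) a c = block d \<psi> (a * m + k) c"
  by (simp add: block_def mid_slice_def algebra_simps)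

lemma ptrace_mid_add:
  "ptrace_mid m d (\<lambda>i j. \<rho> i j + \<sigma> i j) = (\<lambda>i j. ptrace_mid m d \<rho> i j + ptrace_mid m d \<sigma> i j)"
  by (simp add: ptrace_mid_def sum.distrib fun_eq_iff)

lemma ptrace_mid_eq_0:
  assumes "\<And>i j. \<lbrakk>i < N * (m * d); j < N * (m * d)\<rbrakk> \<Longrightarrow> \<rho> i j = 0" "a < N * d" "b < N * d"
  shows "ptrace_mid m d \<rho> a b = 0"
proof -
  have index: "a div d * (m * d) + k * d + a mod d < N * (m * d)" if "a < N * d" "k < m" for a k
  proof -
    have "0 < d" using that by (intro gr0I) simp
    then have "k * d + a mod d < m * d" "a div d < N"
      using that by (simp_all add: mult_add_less_mult div_less_iff_less_mult)
    then show ?thesis using mult_add_less_mult[of "a div d" N "k * d + a mod d" "m * d"] by simp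
  qed
  show ?thesis
    unfolding ptrace_mid_def using assms(2,3) by (intro sum.neutral ballI assms(1) index) auto
qed

lemma trace_ptrace_mid: "trace (N * d) (ptrace_mid m d \<rho>) = trace (N * (m * d)) \<rho>"
proof -
  have "trace (N * d) (ptrace_mid m d \<rho>)
      = (\<Sum>a<N. \<Sum>c<d. \<Sum>k<m. \<rho> (a * (m * d) + k * d + c) (a * (m * d) + k * d + c))"
    by (simp add: trace_def ptrace_mid_def sum_lessThan_mult)
  also have "\<dots> = (\<Sum>a<N. \<Sum>k<m. \<Sum>c<d. \<rho> (a * (m * d) + k * d + c) (a * (m * d) + k * d + c))"
    by (intro sum.cong refl sum.swap)
  also have "\<dots> = trace (N * (m * d)) \<rho>"
    by (simp add: trace_def sum_lessThan_mult add.assoc)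
  finally show ?thesis .
qed

lemma conc_vec_bipartition_eq:
  "(conc_vec 2 (2 * d) \<psi>)\<^sup>2 = 4 * gram_gap d (block d \<psi>)
    + (conc_vec 2 d (mid_slice 2 d \<psi> 0) + conc_vec 2 d (mid_slice 2 d \<psi> 1))\<^sup>2"
proof -
  let ?V = "block d \<psi>"
  let ?A = "gram_det d (?V 0) (?V 2)" and ?B = "gram_det d (?V 1) (?V 3)"
  have slice: "conc_vec 2 d (mid_slice 2 d \<psi> k) = 2 * sqrt (gram_det d (?V k) (?V (2 + k)))" for k
    unfolding conc_vec_qubit
    by (subst gram_det_cong[of d _ "?V k" _ "?V (2 + k)"]) (simp_all add: block_mid_slice)
  have slices: "conc_vec 2 d (mid_slice 2 d \<psi> 0) + conc_vec 2 d (mid_slice 2 d \<psi> 1)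
      = 2 * (sqrt ?A + sqrt ?B)"
    unfolding slice by (simp add: numeral_2_eq_2 numeral_3_eq_3)
  have "gram_det (2 * d) (block (2 * d) \<psi> 0) (block (2 * d) \<psi> 1)
      = ?A + ?B + mixed_gram_det d (?V 0) (?V 2) (?V 1) (?V 3)"
    by (simp add: gram_det_double block_block)
  also have "\<dots> = (sqrt ?A + sqrt ?B)\<^sup>2 + gram_gap d ?V"
    by (simp add: gram_gap_def power2_sum gram_det_nonneg)
  finally have "(conc_vec 2 (2 * d) \<psi>)\<^sup>2 = 4 * ((sqrt ?A + sqrt ?B)\<^sup>2 + gram_gap d ?V)"
    using gram_det_nonneg[of "2 * d" "block (2 * d) \<psi> 0" "block (2 * d) \<psi> 1"]
    by (simp add: conc_vec_qubit power_mult_distrib)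
  then show ?thesis unfolding slices power_mult_distrib by simp
qed

lemma pure_state_monogamy:
  obtains \<kappa> \<mu> where "ensemble_conc_le 2 2 (ptrace_last d (outer \<psi>)) \<kappa>"
    "ensemble_conc_le 2 d (ptrace_mid 2 d (outer \<psi>)) \<mu>" "sqrt (\<kappa>\<^sup>2 + \<mu>\<^sup>2) \<le> conc_vec 2 (2 * d) \<psi>"
proof -
  let ?\<phi> = "mid_slice 2 d \<psi>"
  define \<kappa> where "\<kappa> = 2 * sqrt (gram_gap d (block d \<psi>))"
  define \<mu> where "\<mu> = conc_vec 2 d (?\<phi> 0) + conc_vec 2 d (?\<phi> 1)"
  have last: "ensemble_conc_le 2 2 (ptrace_last d (outer \<psi>)) \<kappa>"
    unfolding \<kappa>_def ptrace_last_outer[abs_def] by (rule ensemble_conc_le_gram)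
  have "is_decomposition (2 * d) (ptrace_mid 2 d (outer \<psi>)) [?\<phi> 0, ?\<phi> 1]"
    by (simp add: is_decomposition_def ptrace_mid_outer numeral_2_eq_2)
  then have mid: "ensemble_conc_le 2 d (ptrace_mid 2 d (outer \<psi>)) \<mu>"
    by (rule ensemble_conc_leI) (simp add: \<mu>_def)
  have "0 \<le> gram_gap d (block d \<psi>)" using ensemble_conc_le_nonneg[OF last] by (simp add: \<kappa>_def)
  then have "\<kappa>\<^sup>2 + \<mu>\<^sup>2 = (conc_vec 2 (2 * d) \<psi>)\<^sup>2"
    by (simp add: \<kappa>_def \<mu>_def conc_vec_bipartition_eq power_mult_distrib)
  then have "sqrt (\<kappa>\<^sup>2 + \<mu>\<^sup>2) \<le> conc_vec 2 (2 * d) \<psi>" by (simp add: conc_vec_nonneg)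
  then show ?thesis using that last mid by blast
qed

lemma decomposition_monogamy:
  assumes "is_decomposition (2 * (2 * d)) \<rho> L"
  shows "\<exists>\<kappa> \<mu>. ensemble_conc_le 2 2 (ptrace_last d \<rho>) \<kappa> \<and> ensemble_conc_le 2 d (ptrace_mid 2 d \<rho>) \<mu>
    \<and> sqrt (\<kappa>\<^sup>2 + \<mu>\<^sup>2) \<le> (\<Sum>v\<leftarrow>L. conc_vec 2 (2 * d) v)"
  using assms
proof (induction L arbitrary: \<rho>)
  case Nil
  then have zero: "\<rho> i j = 0" if "i < 2 * (2 * d)" "j < 2 * (2 * d)" for i j
    using that by (simp add: is_decomposition_def)
  have "ensemble_conc_le 2 2 (ptrace_last d \<rho>) 0"
    using zero by (intro ensemble_conc_le_zero ptrace_last_eq_0[of "2 * 2"]) simp_all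
  moreover have "ensemble_conc_le 2 d (ptrace_mid 2 d \<rho>) 0"
    using zero by (intro ensemble_conc_le_zero ptrace_mid_eq_0[of 2])
  ultimately show ?case by (intro exI[of _ 0]) simp
next
  case (Cons \<psi> L)
  define \<sigma> where "\<sigma> = (\<lambda>i j. \<rho> i j - outer \<psi> i j)"
  have split: "\<rho> = (\<lambda>i j. outer \<psi> i j + \<sigma> i j)" by (simp add: \<sigma>_def)
  have "is_decomposition (2 * (2 * d)) \<sigma> L"
    using Cons.prems by (simp add: is_decomposition_def \<sigma>_def)
  then obtain \<kappa>' \<mu>' where rest: "ensemble_conc_le 2 2 (ptrace_last d \<sigma>) \<kappa>'"
    "ensemble_conc_le 2 d (ptrace_mid 2 d \<sigma>) \<mu>'"
    and rest_le: "sqrt (\<kappa>'\<^sup>2 + \<mu>'\<^sup>2) \<le> (\<Sum>v\<leftarrow>L. conc_vec 2 (2 * d) v)"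
    using Cons.IH by blast
  obtain \<kappa> \<mu> where pure: "ensemble_conc_le 2 2 (ptrace_last d (outer \<psi>)) \<kappa>"
    "ensemble_conc_le 2 d (ptrace_mid 2 d (outer \<psi>)) \<mu>"
    and pure_le: "sqrt (\<kappa>\<^sup>2 + \<mu>\<^sup>2) \<le> conc_vec 2 (2 * d) \<psi>"
    by (rule pure_state_monogamy)
  have "ensemble_conc_le 2 2 (ptrace_last d \<rho>) (\<kappa> + \<kappa>')"
    "ensemble_conc_le 2 d (ptrace_mid 2 d \<rho>) (\<mu> + \<mu>')"
    unfolding split ptrace_last_add ptrace_mid_add
    using pure rest by (simp_all add: ensemble_conc_le_add)
  moreover have "sqrt ((\<kappa> + \<kappa>')\<^sup>2 + (\<mu> + \<mu>')\<^sup>2) \<le> (\<Sum>v\<leftarrow>\<psi> # L. conc_vec 2 (2 * d) v)"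
    using real_sqrt_sum_squares_triangle_ineq[of \<kappa> \<kappa>' \<mu> \<mu>'] pure_le rest_le by simp
  ultimately show ?case by blast
qed

theorem concurrence_monogamy:
  assumes "is_state (2 * (2 * d)) \<rho>"
  shows "0 \<le> conc 2 2 (ptrace_last d \<rho>)" "0 \<le> conc 2 d (ptrace_mid 2 d \<rho>)"
    "sqrt ((conc 2 2 (ptrace_last d \<rho>))\<^sup>2 + (conc 2 d (ptrace_mid 2 d \<rho>))\<^sup>2) \<le> conc 2 (2 * d) \<rho>"
proof -
  let ?C12 = "conc 2 2 (ptrace_last d \<rho>)" and ?C13 = "conc 2 d (ptrace_mid 2 d \<rho>)"
  have trace: "trace (2 * (2 * d)) \<rho> = 1" and "psd (2 * (2 * d)) \<rho>"
    using assms by (simp_all add: is_state_iff)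
  then obtain L where decomposition: "is_decomposition (2 * (2 * d)) \<rho> L"
    using psd_imp_decomposition by blast
  have trace12: "trace (2 * 2) (ptrace_last d \<rho>) = 1"
    and trace13: "trace (2 * d) (ptrace_mid 2 d \<rho>) = 1"
    using trace by (simp_all only: trace_ptrace_last trace_ptrace_mid mult.assoc)
  note bounds = conc_nonneg[OF trace12] conc_nonneg[OF trace13]
    conc_le[OF trace12] conc_le[OF trace13]
  show nonneg: "0 \<le> ?C12" "0 \<le> ?C13"
    using decomposition_monogamy[OF decomposition] bounds(1,2) by blast+
  show "sqrt (?C12\<^sup>2 + ?C13\<^sup>2) \<le> conc 2 (2 * d) \<rho>"
  proof (rule conc_greatest[OF trace decomposition])
    fix M assume "is_decomposition (2 * (2 * d)) \<rho> M"
    then obtain \<kappa> \<mu> where "ensemble_conc_le 2 2 (ptrace_last d \<rho>) \<kappa>"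
      "ensemble_conc_le 2 d (ptrace_mid 2 d \<rho>) \<mu>"
      and bound: "sqrt (\<kappa>\<^sup>2 + \<mu>\<^sup>2) \<le> (\<Sum>v\<leftarrow>M. conc_vec 2 (2 * d) v)"
      using decomposition_monogamy by blast
    then have "?C12 \<le> \<kappa>" "?C13 \<le> \<mu>" using bounds(3,4) by blast+
    then have "sqrt (?C12\<^sup>2 + ?C13\<^sup>2) \<le> sqrt (\<kappa>\<^sup>2 + \<mu>\<^sup>2)"
      using nonneg by (intro real_sqrt_le_mono add_mono power_mono)
    also note bound
    finally show "sqrt (?C12\<^sup>2 + ?C13\<^sup>2) \<le> (\<Sum>v\<leftarrow>M. conc_vec 2 (2 * d) v)" .
  qed
qed

section \<open>Power inequalities\<close>

lemma powr_superadditive: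
  fixes a b q :: real
  assumes "0 \<le> a" "0 \<le> b" "1 \<le> q"
  shows "a powr q + b powr q \<le> (a + b) powr q"
proof -
  have split: "c powr q = c * c powr (q - 1)" if "0 \<le> c" for c
    using that by (simp add: powr_mult_base)
  have "a powr q + b powr q = a * a powr (q - 1) + b * b powr (q - 1)"
    using assms by (simp only: split)
  also have "\<dots> \<le> a * (a + b) powr (q - 1) + b * (a + b) powr (q - 1)"
    using assms by (intro add_mono mult_left_mono powr_mono2) auto
  also have "\<dots> = (a + b) powr q"
    using assms by (simp add: split[of "a + b"] distrib_right)
  finally show ?thesis .
qed

lemma powr_diff_antimono:
  fixes p t u v :: real
  assumes t_bounds: "0 < t" "t \<le> 1 / 2" and p_ge: "1 / 2 \<le> p" and interval: "0 \<le> u" "u \<le> v" "v \<le> 1"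
  shows "(1 + v) powr t - p powr t * v powr t \<le> (1 + u) powr t - p powr t * u powr t"
proof (rule DERIV_nonpos_imp_decreasing_open[OF interval(2)])
  let ?f = "\<lambda>x. (1 + x) powr t - p powr t * x powr t"
  show "continuous_on {u..v} ?f"
    using t_bounds(1) interval by (intro continuous_intros continuous_on_powr') auto
  fix x assume "u < x" "x < v"
  then have x_bounds: "0 < x" "x < 1" using interval by auto
  have "(1 + x) powr (t - 1) = (x * ((1 + x) / x)) powr (t - 1)" using x_bounds by simp
  also have "\<dots> = x powr (t - 1) * ((1 + x) / x) powr (t - 1)" using x_bounds by (intro powr_mult)
  also have "((1 + x) / x) powr (t - 1) \<le> 2 powr (t - 1)"
    using x_bounds t_bounds by (intro powr_mono2') (auto simp: field_simps)
  also have "(2::real) powr (t - 1) \<le> 2 powr (- t)" using t_bounds by (intro powr_mono) auto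
  also have "(2::real) powr (- t) = (1 / 2) powr t" by (simp add: powr_minus_divide powr_divide)
  also have "\<dots> \<le> p powr t" using t_bounds p_ge by (intro powr_mono2) auto
  finally have "(1 + x) powr (t - 1) \<le> p powr t * x powr (t - 1)"
    using x_bounds by (simp add: mult.commute)
  then have "t * (1 + x) powr (t - 1) - p powr t * (t * x powr (t - 1)) \<le> 0"
    using t_bounds by (simp add: mult.left_commute)
  moreover have "(?f has_real_derivative
      t * (1 + x) powr (t - 1) - p powr t * (t * x powr (t - 1))) (at x)"
    using x_bounds by (auto intro!: derivative_eq_intros)
  ultimately show "\<exists>y. (?f has_real_derivative y) (at x) \<and> y \<le> 0" by blast
qed

lemma weighted_powr_add_le:
  fixes a b k p t :: real
  assumes t_bounds: "0 \<le> t" "t \<le> 1 / 2" and p_ge: "1 / 2 \<le> p" and k_ge: "1 \<le> k"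
    and nonneg: "0 \<le> a" "0 \<le> b" and dominated: "k * a \<le> b"
  shows "p powr t * a powr t + ((1 + k) powr t - p powr t) / k powr t * b powr t \<le> (a + b) powr t"
proof (cases "t = 0 \<or> b = 0")
  case True
  have "0 \<le> k * a" using k_ge nonneg by simp
  then have "a = 0" if "b = 0" using that dominated nonneg k_ge by (simp add: mult_le_0_iff)
  then show ?thesis using True p_ge k_ge nonneg by (auto simp: add_nonneg_eq_0_iff)
next
  case False
  then have t_pos: "0 < t" and b_pos: "0 < b" using t_bounds nonneg by auto
  have "((1 + k) powr t - p powr t) / k powr t = (1 + 1 / k) powr t - p powr t * (1 / k) powr t"
  proof -
    have "(1 + k) powr t / k powr t = (1 + 1 / k) powr t"
      using k_ge by (simp add: add_divide_distrib add.commute flip: powr_divide)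
    then show ?thesis using k_ge by (simp add: diff_divide_distrib powr_divide)
  qed
  also have "\<dots> \<le> (1 + a / b) powr t - p powr t * (a / b) powr t"
    using t_pos t_bounds(2) p_ge k_ge nonneg dominated b_pos
    by (intro powr_diff_antimono) (auto simp: field_simps)
  finally have "((1 + k) powr t - p powr t) / k powr t * b powr t
      \<le> ((1 + a / b) powr t - p powr t * (a / b) powr t) * b powr t"
    by (intro mult_right_mono) auto
  also have "\<dots> = ((1 + a / b) * b) powr t - p powr t * (a / b * b) powr t"
    using nonneg by (simp only: left_diff_distrib mult.assoc powr_mult)
  also have "\<dots> = (a + b) powr t - p powr t * a powr t"
    using b_pos by (simp add: distrib_right add.commute)
  finally show ?thesis by simp
qed

lemma weighted_powr_le:
  fixes x y z k p r \<alpha> :: real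
  assumes nonneg: "0 \<le> x" "0 \<le> y" and hypotenuse: "sqrt (x\<^sup>2 + y\<^sup>2) \<le> z"
    and k_ge: "1 \<le> k" and p_ge: "1 / 2 \<le> p" and r_ge: "2 \<le> r" and exponent: "0 \<le> \<alpha>" "\<alpha> \<le> r / 2"
    and dominated: "k * x powr r \<le> y powr r"
  shows "p powr (\<alpha> / r) * x powr \<alpha>
    + ((1 + k) powr (\<alpha> / r) - p powr (\<alpha> / r)) / k powr (\<alpha> / r) * y powr \<alpha> \<le> z powr \<alpha>"
proof -
  let ?t = "\<alpha> / r"
  have root: "(c powr r) powr ?t = c powr \<alpha>" for c :: real
    using r_ge by (simp add: powr_powr)
  have square: "(c\<^sup>2) powr (r / 2) = c powr r" if "0 \<le> c" for c :: real
    using that by (simp add: powr_powr flip: powr_numeral)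
  have "x powr r + y powr r \<le> (x\<^sup>2 + y\<^sup>2) powr (r / 2)"
    using powr_superadditive[of "x\<^sup>2" "y\<^sup>2" "r / 2"] nonneg r_ge by (simp add: square)
  also have "\<dots> = sqrt (x\<^sup>2 + y\<^sup>2) powr r"
    using square[of "sqrt (x\<^sup>2 + y\<^sup>2)"] by simp
  also have "\<dots> \<le> z powr r" using nonneg hypotenuse r_ge by (intro powr_mono2) auto
  finally have "(x powr r + y powr r) powr ?t \<le> (z powr r) powr ?t"
    using r_ge exponent by (intro powr_mono2) auto
  moreover have "p powr ?t * (x powr r) powr ?t
      + ((1 + k) powr ?t - p powr ?t) / k powr ?t * (y powr r) powr ?t
      \<le> (x powr r + y powr r) powr ?t"
    using r_ge exponent p_ge k_ge dominated by (intro weighted_powr_add_le) (auto simp: field_simps)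
  ultimately show ?thesis unfolding root by linarith
qed

theorem theorem1:
  fixes n :: nat and \<rho> :: "nat \<Rightarrow> nat \<Rightarrow> complex" and k p r \<alpha> :: real
  assumes "n \<ge> 3"
    and "is_state (2 * 2 * 2 ^ (n - 2)) \<rho>"
    and "k \<ge> 1" and "1 / 2 \<le> p" and "p \<le> 1" and "r \<ge> 2"
    and "0 \<le> \<alpha>" and "\<alpha> \<le> r / 2"
  shows "let d3 = (2::nat) ^ (n - 2);
             C12 = conc 2 2 (ptrace_last d3 \<rho>);
             C13 = conc 2 d3 (ptrace_mid 2 d3 \<rho>);
             C1_23 = conc 2 (2 * d3) \<rho>;
             l = ((1 + k) powr (\<alpha> / r) - p powr (\<alpha> / r)) / k powr (\<alpha> / r)
         in (C13 powr r \<ge> k * C12 powr r \<longrightarrow>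
               C1_23 powr \<alpha> \<ge> p powr (\<alpha> / r) * C12 powr \<alpha> + l * C13 powr \<alpha>) \<and>
            (C12 powr r \<ge> k * C13 powr r \<longrightarrow>
               C1_23 powr \<alpha> \<ge> p powr (\<alpha> / r) * C13 powr \<alpha> + l * C12 powr \<alpha>)"
proof -
  define d where "d = (2::nat) ^ (n - 2)"
  have "is_state (2 * (2 * d)) \<rho>" using assms(2) by (simp add: d_def)
  note monogamy = concurrence_monogamy[OF this]
  note monogamy_swapped = monogamy(2,1) monogamy(3)[unfolded add.commute[of "(conc 2 2 _)\<^sup>2"]]
  show ?thesis
    unfolding Let_def d_def[symmetric]
    using weighted_powr_le[OF monogamy assms(3,4,6-8)]
      weighted_powr_le[OF monogamy_swapped assms(3,4,6-8)]
    by blast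
qed

end
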